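(* Let $G$ and $H$ be two nontrivial connected graphs. (1) If both $G$ and $H$ are complete, then $pvc(G\boxtimes H)=0$; if $diam(G)\geq3$ or $diam(H)\geq3$, then $pvc(G\boxtimes H)=2$; otherwise $pvc(G\boxtimes H)=1$. (2) Say a graph $X$ has property (P) if there exist two vertices of $X$ at distance $2$ that have exactly one common neighbor. If $diam(G)\leq 2$ and $diam(H)\leq2$, except in the case that $diam(G)=diam(H)=2$ and both $G$ and $H$ have property (P), then $pvc_2(G\boxtimes H)=1$; otherwise $pvc_2(G\boxtimes H)=2$. (3) If both $G$ and $H$ are complete, then $spvc(G\boxtimes H)=0$. If either ($diam(G)=2$ and $diam(H)\leq2$) or ($diam(G)\leq2$ and $diam(H)=2$), then $spvc(G\boxtimes H)=1$. If $diam(G)\leq2$ and $diam(H)\geq3$, then $spvc(G\boxtimes H)\leq spvc(H)$, and this bound is sharp (attained for some such $G$ and $H$). If $diam(G)\geq3$ and $diam(H)\geq3$, then $spvc(G\boxtimes H)\leq spvc(G)\cdot spvc(H)$.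
   Context: All graphs are simple, finite and undirected; nontrivial means having at least two vertices. The strong product $G\boxtimes H$ has vertex set $V(G)\times V(H)$, with $(g,h)$ adjacent to $(g',h')$ iff ($gg'\in E(G)$ and $h=h'$), or ($g=g'$ and $hh'\in E(H)$), or ($gg'\in E(G)$ and $hh'\in E(H)$). A set of paths between two vertices is called disjoint if they are internally vertex-disjoint. In a vertex-colored graph, a path is vertex-proper if any two adjacent internal vertices of the path receive different colors. A vertex-colored graph is proper vertex $k$-connected if any two vertices are joined by $k$ disjoint vertex-proper paths. For a $k$-connected graph $G$, $pvc_k(G)$ is the smallest number of colors in a vertex-coloring making $G$ proper vertex $k$-connected; $pvc(G)=pvc_1(G)$, with $pvc(G)=0$ for complete $G$ (for $k\ge2$, $pvc_k(G)\ge1$). A $u$-$v$ geodesic is a $u$-$v$ path of length $d(u,v)$. A vertex-colored graph is strong proper vertex-connected if for any two vertices $u,v$ there is a vertex-proper $u$-$v$ geodesic; $spvc(G)$ is the smallest number of colors needed for this, with $spvc(G)=0$ for complete $G$. *)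

theory Defs
  imports "Graph_Theory.Graph_Theory"
begin

text \<open>Finite simple undirected graphs are the symmetric loop-free digraphs satisfying
  \<^const>\<open>pair_graph\<close>; an edge \<open>uv\<close> is the pair of arcs \<open>(u, v)\<close>, \<open>(v, u)\<close> in \<^const>\<open>parcs\<close>.\<close>

definition strong_product ::
    "'a pair_pre_digraph \<Rightarrow> 'b pair_pre_digraph \<Rightarrow> ('a \<times> 'b) pair_pre_digraph"
    (infixl "\<boxtimes>" 75) where
  "G \<boxtimes> H = \<lparr> pverts = pverts G \<times> pverts H,
     parcs = {((g, h), (g', h')).
        (g, g') \<in> parcs G \<and> h = h' \<and> h \<in> pverts H \<or>
        g = g' \<and> g \<in> pverts G \<and> (h, h') \<in> parcs H \<or>
        (g, g') \<in> parcs G \<and> (h, h') \<in> parcs H} \<rparr>"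

lemma pair_graph_strong_product:
  assumes "pair_graph G" "pair_graph H"
  shows "pair_graph (G \<boxtimes> H)"
proof -
  interpret G: pair_graph G by fact
  interpret H: pair_graph H by fact
  have sub: "parcs (G \<boxtimes> H) \<subseteq> pverts (G \<boxtimes> H) \<times> pverts (G \<boxtimes> H)"
    by (auto simp: strong_product_def dest: G.in_arcsD1 G.in_arcsD2 H.in_arcsD1 H.in_arcsD2)
  have fin: "finite (pverts (G \<boxtimes> H))"
    by (simp add: strong_product_def G.pair_finite_verts H.pair_finite_verts)
  have "finite (parcs (G \<boxtimes> H))"
    using sub fin by (meson finite_SigmaI finite_subset)
  moreover have "symmetric (with_proj (G \<boxtimes> H))"
    using G.pair_sym_arcs H.pair_sym_arcs
    by (auto simp: symmetric_def strong_product_def sym_def)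
  moreover have "fst e \<noteq> snd e" if "e \<in> parcs (G \<boxtimes> H)" for e
    using that G.no_loops' H.no_loops' by (auto simp: strong_product_def)
  ultimately show ?thesis
    using sub fin by unfold_locales auto
qed

definition complete_graph :: "'a pair_pre_digraph \<Rightarrow> bool" where
  "complete_graph G \<longleftrightarrow> complete_digraph (card (pverts G)) (with_proj G)"

definition paths_between :: "'a pair_pre_digraph \<Rightarrow> 'a \<Rightarrow> 'a \<Rightarrow> 'a list set" where
  "paths_between G u v = {p. vpath p (with_proj G) \<and> hd p = u \<and> last p = v}"

definition gdist :: "'a pair_pre_digraph \<Rightarrow> 'a \<Rightarrow> 'a \<Rightarrow> nat" where
  "gdist G u v = (LEAST n. \<exists>p \<in> paths_between G u v. vwalk_length p = n)"

definition diam :: "'a pair_pre_digraph \<Rightarrow> nat" where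
  "diam G = Max {gdist G u v | u v. u \<in> pverts G \<and> v \<in> pverts G}"

definition geodesics :: "'a pair_pre_digraph \<Rightarrow> 'a \<Rightarrow> 'a \<Rightarrow> 'a list set" where
  "geodesics G u v = {p \<in> paths_between G u v. vwalk_length p = gdist G u v}"

definition internal_verts :: "'a list \<Rightarrow> 'a list" where
  "internal_verts p = butlast (tl p)"

definition internally_disjoint :: "'a list set \<Rightarrow> bool" where
  "internally_disjoint P \<longleftrightarrow>
     (\<forall>p \<in> P. \<forall>q \<in> P. p \<noteq> q \<longrightarrow> set (internal_verts p) \<inter> set (internal_verts q) = {})"

text \<open>Adjacent internal vertices of a path are consecutive ones; the two end vertices are
  not constrained. Colorings need not be proper colorings of the graph.\<close>

definition vertex_proper :: "('a \<Rightarrow> nat) \<Rightarrow> 'a list \<Rightarrow> bool" where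
  "vertex_proper c p \<longleftrightarrow> distinct_adj (map c (internal_verts p))"

definition proper_vertex_connected ::
    "nat \<Rightarrow> 'a pair_pre_digraph \<Rightarrow> ('a \<Rightarrow> nat) \<Rightarrow> bool" where
  "proper_vertex_connected k G c \<longleftrightarrow>
     (\<forall>u \<in> pverts G. \<forall>v \<in> pverts G. u \<noteq> v \<longrightarrow>
       (\<exists>P \<subseteq> paths_between G u v. finite P \<and> card P = k \<and> internally_disjoint P \<and>
          (\<forall>p \<in> P. vertex_proper c p)))"

definition strong_proper_vertex_connected ::
    "'a pair_pre_digraph \<Rightarrow> ('a \<Rightarrow> nat) \<Rightarrow> bool" where
  "strong_proper_vertex_connected G c \<longleftrightarrow>
     (\<forall>u \<in> pverts G. \<forall>v \<in> pverts G. u \<noteq> v \<longrightarrow> (\<exists>p \<in> geodesics G u v. vertex_proper c p))"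

text \<open>A coloring with \<open>n\<close> colors maps the vertices into \<open>{..<n}\<close>, so \<open>n \<ge> 1\<close> on a nonempty graph;
  the value 0 on complete graphs is a convention, made for \<open>pvc\<^sub>1\<close> and \<open>spvc\<close> only.
  As in the literature, \<open>pvc_k k G\<close> is meaningful for \<open>k\<close>-connected \<open>G\<close> (and \<open>spvc G\<close> for
  connected \<open>G\<close>): there an injective coloring shows that the minimum exists. Otherwise the
  \<open>LEAST\<close> ranges over no numbers and its value is unspecified.\<close>

definition pvc_k :: "nat \<Rightarrow> 'a pair_pre_digraph \<Rightarrow> nat" where
  "pvc_k k G =
     (if k = 1 \<and> complete_graph G then 0
      else LEAST n. \<exists>c. c ` pverts G \<subseteq> {..<n} \<and> proper_vertex_connected k G c)"

abbreviation pvc :: "'a pair_pre_digraph \<Rightarrow> nat" where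
  "pvc \<equiv> pvc_k 1"

definition spvc :: "'a pair_pre_digraph \<Rightarrow> nat" where
  "spvc G =
     (if complete_graph G then 0
      else LEAST n. \<exists>c. c ` pverts G \<subseteq> {..<n} \<and> strong_proper_vertex_connected G c)"

definition nontrivial_connected_graph :: "'a pair_pre_digraph \<Rightarrow> bool" where
  "nontrivial_connected_graph G \<longleftrightarrow>
     pair_graph G \<and> 2 \<le> card (pverts G) \<and> Digraph_Component.connected (with_proj G)"

definition property_P :: "'a pair_pre_digraph \<Rightarrow> bool" where
  "property_P G \<longleftrightarrow>
     (\<exists>u \<in> pverts G. \<exists>v \<in> pverts G. gdist G u v = 2 \<and>
        (\<exists>!w. (u, w) \<in> parcs G \<and> (v, w) \<in> parcs G))"

end

theory Submission
  imports Defs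
begin

text \<open>Distances are described by lazy walks, which may stay at a vertex: a lazy walk in \<open>G \<boxtimes> H\<close> is
  a pair of lazy walks of the same length, so distances in \<open>G \<boxtimes> H\<close> are maxima, and a geodesic of the
  factor with the larger distance, paired with a lazy walk in the other factor, is a geodesic.
  It is vertex-proper as soon as its projection is, which gives the bounds on \<^const>\<open>spvc\<close>.

  With one color exactly the paths with at most one internal vertex are vertex-proper, so the values 1
  and the lower bounds are statements about common neighbors; those of \<open>(g, h)\<close> and \<open>(g', h')\<close> are
  pairs of midpoints. For two colors, color each factor by the parity of the distance to a root and
  \<open>G \<boxtimes> H\<close> by the sum modulo 2. Any two vertices of a factor are joined by a path with alternating
  colors, and two disjoint alternating paths in the product run along rows and columns, as in a
  Cartesian product of two trees.\<close>

section \<open>Lists\<close>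

text \<open>Induction on \<open>p\<close>: if the new first vertex already lies on the shortened
  list \<open>q\<close>, everything before its occurrence is cut off; otherwise it differs from
  \<open>hd q\<close>, so the step is not a pause and \<open>R\<close> holds. Pauses and cycles
  disappear together.\<close>

lemma successively_imp_distinct:
  assumes "successively (\<lambda>x y. x = y \<or> R x y) p" "p \<noteq> []"
  obtains q where "q \<noteq> []" "distinct q" "successively R q" "set q \<subseteq> set p"
    "hd q = hd p" "last q = last p" "length q \<le> length p"
proof -
  have "\<exists>q. q \<noteq> [] \<and> distinct q \<and> successively R q \<and> set q \<subseteq> set p \<and>
    hd q = hd p \<and> last q = last p \<and> length q \<le> length p"
    using assms
  proof (induction p)
    case (Cons x p)
    show ?case
    proof (cases "p = []")
      case True
      then show ?thesis by (intro exI[of _ "[x]"]) auto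
    next
      case False
      with Cons obtain q where q: "q \<noteq> []" "distinct q" "successively R q" "set q \<subseteq> set p"
        "hd q = hd p" "last q = last p" "length q \<le> length p"
        by (auto simp: successively_Cons)
      show ?thesis
      proof (cases "x \<in> set q")
        case True
        then obtain ys zs where yz: "q = ys @ x # zs" by (auto simp: in_set_conv_decomp)
        show ?thesis
          using q yz False by (intro exI[of _ "x # zs"]) (auto simp: successively_append_iff)
      next
        case nin: False
        then have "x \<noteq> hd p" using q by (metis hd_in_set)
        then have "R x (hd q)" using Cons.prems q False by (auto simp: successively_Cons)
        then show ?thesis
          using q False nin by (intro exI[of _ "x # q"]) (auto simp: successively_Cons)
      qed
    qed
  qed simp
  then show thesis using that by blast
qed

lemma rtranclp_imp_successively:
  assumes "R\<^sup>*\<^sup>* u v"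
  shows "\<exists>p. p \<noteq> [] \<and> successively R p \<and> hd p = u \<and> last p = v"
  using assms
proof (induction rule: converse_rtranclp_induct)
  case base
  then show ?case by (intro exI[of _ "[v]"]) auto
next
  case (step y z)
  then obtain p where "p \<noteq> []" "successively R p" "hd p = z" "last p = v" by auto
  with step show ?case by (intro exI[of _ "y # p"]) (auto simp: successively_Cons)
qed

lemma successively_zip:
  assumes "length p = length q"
  shows "successively R (zip p q) \<longleftrightarrow>
    (\<forall>i. Suc i < length p \<longrightarrow> R (p ! i, q ! i) (p ! Suc i, q ! Suc i))"
  using assms by (auto simp: successively_conv_nth)

lemma set_internal_verts:
  assumes "distinct p"
  shows "set (internal_verts p) = set p - {hd p, last p}"
proof (cases p)
  case (Cons x xs)
  show ?thesis
  proof (cases "xs = []")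
    case False
    then obtain ys y where "xs = ys @ [y]" by (metis rev_exhaust)
    then show ?thesis using assms Cons by (auto simp: internal_verts_def)
  qed (simp add: Cons internal_verts_def)
qed (simp add: internal_verts_def)

lemma distinct_adj_imp_vertex_proper:
  assumes "distinct_adj (map c p)"
  shows "vertex_proper c p"
proof -
  have "distinct_adj (tl xs)" if "distinct_adj xs" for xs :: "nat list"
    using that by (cases xs) (auto dest: distinct_adj_ConsD)
  moreover have "distinct_adj (butlast xs)" if "distinct_adj xs" for xs :: "nat list"
    using that by (cases xs rule: rev_cases) auto
  ultimately show ?thesis
    using assms by (simp add: vertex_proper_def internal_verts_def map_tl map_butlast)
qed

text \<open>At most one vertex is internal, so there are no two colors to compare.\<close>

lemma vertex_proper_short: "length p \<le> 3 \<Longrightarrow> vertex_proper c p"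
proof -
  assume "length p \<le> 3"
  then have "length (internal_verts p) \<le> 1" by (simp add: internal_verts_def)
  then have "internal_verts p = [] \<or> (\<exists>x. internal_verts p = [x])"
    by (cases "internal_verts p") auto
  then show ?thesis by (auto simp: vertex_proper_def)
qed

lemma vertex_proper_map: "vertex_proper c (map f p) \<longleftrightarrow> vertex_proper (c \<circ> f) p"
  by (simp add: vertex_proper_def internal_verts_def map_tl map_butlast)

text \<open>On \<open>p\<close> the coloring \<open>c'\<close> refines \<open>c\<close>, so it
  separates whatever \<open>c\<close> separates. This passes from the coloring of one factor to a
  coloring by pairs.\<close>

lemma vertex_proper_coarser:
  assumes "vertex_proper c p" "\<And>x y. x \<in> set p \<Longrightarrow> y \<in> set p \<Longrightarrow> c' x = c' y \<Longrightarrow> c x = c y"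
  shows "vertex_proper c' p"
proof -
  have sub: "set (internal_verts p) \<subseteq> set p"
    by (cases p) (auto simp: internal_verts_def dest: in_set_butlastD)
  show ?thesis
    using assms(1) unfolding vertex_proper_def distinct_adj_def successively_map
    by (rule successively_mono) (use sub assms(2) in blast)
qed

text \<open>A fourth vertex would give two consecutive internal vertices, both of color 0. Every
  lower bound of 2 rests on this.\<close>

lemma vertex_proper_constant_imp_short:
  assumes "vertex_proper c p" "c ` set p \<subseteq> {..<1}"
  shows "length p \<le> 3"
proof (rule ccontr)
  assume "\<not> length p \<le> 3"
  then obtain x y z w q where p: "p = x # y # z # w # q"
    by (cases p; cases "tl p"; cases "tl (tl p)"; cases "tl (tl (tl p))") auto
  then obtain r where "internal_verts p = y # z # r"
    by (auto simp: internal_verts_def split: if_splits)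
  then show False using assms p by (auto simp: vertex_proper_def)
qed

section \<open>Distances and lazy walks\<close>

lemma nontrivial_connected_graphD:
  assumes "nontrivial_connected_graph G"
  shows "(u, v) \<in> parcs G \<Longrightarrow> u \<in> pverts G"
    and "(u, v) \<in> parcs G \<Longrightarrow> v \<in> pverts G"
    and "(u, v) \<in> parcs G \<Longrightarrow> u \<noteq> v"
    and "(u, v) \<in> parcs G \<Longrightarrow> (v, u) \<in> parcs G"
    and "finite (pverts G)"
    and "pverts G \<noteq> {}"
proof -
  interpret pair_graph G using assms by (simp add: nontrivial_connected_graph_def)
  show "(u, v) \<in> parcs G \<Longrightarrow> u \<in> pverts G" by (rule in_arcsD1)
  show "(u, v) \<in> parcs G \<Longrightarrow> v \<in> pverts G" by (rule in_arcsD2)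
  show "(u, v) \<in> parcs G \<Longrightarrow> u \<noteq> v" by (rule no_loops')
  show "(u, v) \<in> parcs G \<Longrightarrow> (v, u) \<in> parcs G"
    using pair_sym_arcs by (auto simp: symmetric_def sym_def)
  show "finite (pverts G)" by (rule pair_finite_verts)
  show "pverts G \<noteq> {}" using assms by (auto simp: nontrivial_connected_graph_def)
qed

lemma set_vwalk_arcs_subset_iff:
  "set (vwalk_arcs p) \<subseteq> E \<longleftrightarrow> successively (\<lambda>x y. (x, y) \<in> E) p"
  by (induction p rule: vwalk_arcs.induct) auto

lemma paths_between_iff:
  "p \<in> paths_between G u v \<longleftrightarrow> p \<noteq> [] \<and> set p \<subseteq> pverts G \<and> distinct p \<and>
     successively (\<lambda>x y. (x, y) \<in> parcs G) p \<and> hd p = u \<and> last p = v"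
  by (auto simp: paths_between_def vpath_def vwalk_def set_vwalk_arcs_subset_iff)

text \<open>The reflexive closure of adjacency, restricted to vertices. In this form adjacency in a
  strong product is componentwise, and walks can be padded to any larger length.\<close>

definition lazy_adj :: "'a pair_pre_digraph \<Rightarrow> 'a \<Rightarrow> 'a \<Rightarrow> bool" where
  "lazy_adj G u v \<longleftrightarrow> u \<in> pverts G \<and> v \<in> pverts G \<and> (u = v \<or> (u, v) \<in> parcs G)"

definition lazy_walk :: "'a pair_pre_digraph \<Rightarrow> nat \<Rightarrow> 'a \<Rightarrow> 'a \<Rightarrow> 'a list \<Rightarrow> bool" where
  "lazy_walk G n u v p \<longleftrightarrow>
     length p = Suc n \<and> set p \<subseteq> pverts G \<and> successively (lazy_adj G) p \<and> hd p = u \<and> last p = v"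

lemma lazy_adj_sym: "nontrivial_connected_graph G \<Longrightarrow> lazy_adj G u v \<Longrightarrow> lazy_adj G v u"
  by (auto simp: lazy_adj_def dest: nontrivial_connected_graphD)

lemma arc_iff_lazy_adj:
  assumes "nontrivial_connected_graph G"
  shows "(u, v) \<in> parcs G \<longleftrightarrow> lazy_adj G u v \<and> u \<noteq> v"
  by (auto simp: lazy_adj_def dest: nontrivial_connected_graphD(1-3)[OF assms])

lemma lazy_walk_path:
  assumes "p \<in> paths_between G u v"
  shows "lazy_walk G (vwalk_length p) u v p"
proof -
  have p: "p \<noteq> []" "set p \<subseteq> pverts G" "successively (\<lambda>x y. (x, y) \<in> parcs G) p" "hd p = u" "last p = v"
    using assms by (auto simp: paths_between_iff)
  have "successively (lazy_adj G) p"
    using p(3) by (rule successively_mono) (use p(2) in \<open>auto simp: lazy_adj_def\<close>)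
  then show ?thesis using p by (auto simp: lazy_walk_def)
qed

lemma lazy_walk_ends:
  assumes "lazy_walk G n u v p"
  shows "u \<in> pverts G" "v \<in> pverts G"
proof -
  have "p \<noteq> []" "set p \<subseteq> pverts G" "hd p = u" "last p = v" using assms by (auto simp: lazy_walk_def)
  then show "u \<in> pverts G" "v \<in> pverts G" using hd_in_set[of p] last_in_set[of p] by blast+
qed

lemma lazy_walk_imp_path:
  assumes "lazy_walk G n u v p"
  obtains q where "q \<in> paths_between G u v" "vwalk_length q \<le> n"
proof -
  have "p \<noteq> []" using assms by (auto simp: lazy_walk_def)
  have "successively (\<lambda>x y. x = y \<or> (x, y) \<in> parcs G) p"
    using assms unfolding lazy_walk_def
    by (elim conjE successively_mono) (auto simp: lazy_adj_def)
  then obtain q where "q \<noteq> []" "distinct q" "successively (\<lambda>x y. (x, y) \<in> parcs G) q"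
    "set q \<subseteq> set p" "hd q = hd p" "last q = last p" "length q \<le> length p"
    using \<open>p \<noteq> []\<close> by (rule successively_imp_distinct)
  with assms show ?thesis by (intro that[of q]) (auto simp: lazy_walk_def paths_between_iff)
qed

text \<open>The walk waits at its last vertex \<open>v\<close> for the remaining
  \<open>m - n\<close> steps.\<close>

lemma lazy_walk_extend:
  assumes "lazy_walk G n u v p" "n \<le> m"
  obtains q where "lazy_walk G m u v q"
proof -
  have p: "length p = Suc n" "set p \<subseteq> pverts G" "successively (lazy_adj G) p" "hd p = u" "last p = v"
    using assms by (auto simp: lazy_walk_def)
  have v: "v \<in> pverts G" by (rule lazy_walk_ends[OF assms(1)])
  have "successively (lazy_adj G) (replicate k v)" for k
    using v by (auto simp: successively_conv_nth lazy_adj_def)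
  then have "lazy_walk G m u v (p @ replicate (m - n) v)"
    using p v assms(2) by (cases "m = n") (auto simp: lazy_walk_def successively_append_iff lazy_adj_def hd_append)
  then show ?thesis by (rule that)
qed

lemma ex_path:
  assumes "nontrivial_connected_graph G" "u \<in> pverts G" "v \<in> pverts G"
  shows "paths_between G u v \<noteq> {}"
proof -
  interpret pair_graph G using assms by (simp add: nontrivial_connected_graph_def)
  \<comment> \<open>Connectedness is defined as strong connectedness of the symmetric closure; since
    the arcs of \<open>G\<close> are already symmetric, reachability is the same.\<close>
  have "u \<rightarrow>\<^sup>*\<^bsub>mk_symmetric G\<^esub> v"
    using assms unfolding nontrivial_connected_graph_def connected_def strongly_connected_def by simp
  then have "u \<rightarrow>\<^sup>*\<^bsub>G\<^esub> v" using reachable_mk_symmetric_eq pair_sym_arcs by blast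
  then show ?thesis using reachable_vpath_conv by (auto simp: paths_between_def)
qed

lemma ex_geodesic:
  assumes "nontrivial_connected_graph G" "u \<in> pverts G" "v \<in> pverts G"
  obtains p where "p \<in> geodesics G u v"
proof -
  have "\<exists>n. \<exists>p \<in> paths_between G u v. vwalk_length p = n" using ex_path[OF assms] by blast
  from LeastI_ex[OF this] obtain p where "p \<in> paths_between G u v" "vwalk_length p = gdist G u v"
    unfolding gdist_def by blast
  then show ?thesis using that by (auto simp: geodesics_def)
qed

lemma gdist_le_path: "p \<in> paths_between G u v \<Longrightarrow> gdist G u v \<le> vwalk_length p"
  unfolding gdist_def by (rule Least_le) auto

text \<open>A geodesic can be padded to exactly \<open>n\<close> steps, and a lazy walk can be
  shortened to a path. This replaces the \<open>LEAST\<close> in \<open>gdist\<close> by the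
  existence of walks of one fixed length, which can be zipped.\<close>

lemma gdist_le_iff:
  assumes "nontrivial_connected_graph G" "u \<in> pverts G" "v \<in> pverts G"
  shows "gdist G u v \<le> n \<longleftrightarrow> (\<exists>p. lazy_walk G n u v p)"
proof
  assume *: "gdist G u v \<le> n"
  obtain p where "p \<in> geodesics G u v" by (rule ex_geodesic[OF assms])
  then have "lazy_walk G (gdist G u v) u v p"
    using lazy_walk_path[of p G u v] by (simp add: geodesics_def del: vwalk_length_simp)
  then show "\<exists>p. lazy_walk G n u v p" using lazy_walk_extend * by metis
next
  assume "\<exists>p. lazy_walk G n u v p"
  then obtain q where "q \<in> paths_between G u v" "vwalk_length q \<le> n"
    using lazy_walk_imp_path by metis
  then show "gdist G u v \<le> n" using gdist_le_path[of q G u v] by linarith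
qed

lemma gdist_le_1_iff:
  assumes "nontrivial_connected_graph G" "u \<in> pverts G" "v \<in> pverts G"
  shows "gdist G u v \<le> 1 \<longleftrightarrow> lazy_adj G u v"
proof -
  have "lazy_walk G 1 u v p \<longleftrightarrow> p = [u, v] \<and> lazy_adj G u v" for p
    by (cases p; cases "tl p") (auto simp: lazy_walk_def lazy_adj_def)
  then show ?thesis using gdist_le_iff[OF assms, of 1] by simp
qed

lemma gdist_le_2_iff:
  assumes "nontrivial_connected_graph G" "u \<in> pverts G" "v \<in> pverts G"
  shows "gdist G u v \<le> 2 \<longleftrightarrow> (\<exists>w. lazy_adj G u w \<and> lazy_adj G w v)"
proof -
  have "lazy_walk G 2 u v p \<longleftrightarrow> (\<exists>w. p = [u, w, v] \<and> lazy_adj G u w \<and> lazy_adj G w v)" for p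
    by (cases p; cases "tl p"; cases "tl (tl p)") (auto simp: lazy_walk_def lazy_adj_def)
  then show ?thesis using gdist_le_iff[OF assms, of 2] by auto
qed

lemma gdist_eq_0_iff:
  assumes "nontrivial_connected_graph G" "u \<in> pverts G" "v \<in> pverts G"
  shows "gdist G u v = 0 \<longleftrightarrow> u = v"
proof -
  have "lazy_walk G 0 u v p \<longleftrightarrow> p = [u] \<and> u = v" for p
    using assms by (cases p) (auto simp: lazy_walk_def)
  then show ?thesis using gdist_le_iff[OF assms, of 0] by simp
qed

text \<open>Take the last but one vertex \<open>w\<close> of a lazy walk with \<open>Suc n\<close>
  steps. It is reached in \<open>n\<close> steps, and not in fewer, because one more step leads to
  \<open>v\<close>. As the distances of \<open>w\<close> and \<open>v\<close> differ, the final step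
  is an arc.\<close>

lemma gdist_pred:
  assumes G: "nontrivial_connected_graph G" and u: "u \<in> pverts G" and v: "v \<in> pverts G"
    and d: "gdist G u v = Suc n"
  obtains w where "gdist G u w = n" "(w, v) \<in> parcs G"
proof -
  obtain p where p: "lazy_walk G (Suc n) u v p" using gdist_le_iff[OF G u v, of "Suc n"] d by auto
  then obtain q where q: "p = q @ [v]" "length q = Suc n"
    by (cases p rule: rev_cases) (auto simp: lazy_walk_def)
  define w where "w = last q"
  have qn: "q \<noteq> []" using q by auto
  then have w: "w \<in> pverts G" "lazy_walk G n u w q" "lazy_adj G w v"
    using p q by (auto simp: lazy_walk_def w_def successively_append_iff)
  then have le: "gdist G u w \<le> n" using gdist_le_iff[OF G u] by blast
  have "n \<le> gdist G u w"
  proof -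
    obtain r where r: "lazy_walk G (gdist G u w) u w r" using gdist_le_iff[OF G u w(1)] by blast
    then have "r \<noteq> []" by (auto simp: lazy_walk_def)
    then have "lazy_walk G (Suc (gdist G u w)) u v (r @ [v])"
      using r w(3) v by (auto simp: lazy_walk_def successively_append_iff)
    then have "gdist G u v \<le> Suc (gdist G u w)" using gdist_le_iff[OF G u v] by blast
    then show ?thesis using d by simp
  qed
  with le have eq: "gdist G u w = n" by simp
  with d have "w \<noteq> v" by auto
  with w(3) have "(w, v) \<in> parcs G" by (simp add: lazy_adj_def)
  with eq show ?thesis by (rule that)
qed

section \<open>Diameter and completeness\<close>

lemma finite_gdists:
  assumes "nontrivial_connected_graph G"
  shows "finite {gdist G u v | u v. u \<in> pverts G \<and> v \<in> pverts G}"
proof -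
  have "{gdist G u v | u v. u \<in> pverts G \<and> v \<in> pverts G} = (\<lambda>(u, v). gdist G u v) ` (pverts G \<times> pverts G)"
    by auto
  then show ?thesis using nontrivial_connected_graphD(5)[OF assms] by simp
qed

lemma gdist_le_diam:
  assumes "nontrivial_connected_graph G" "u \<in> pverts G" "v \<in> pverts G"
  shows "gdist G u v \<le> diam G"
  unfolding diam_def using assms finite_gdists by (intro Max_ge) auto

lemma diam_attained:
  assumes "nontrivial_connected_graph G"
  obtains u v where "u \<in> pverts G" "v \<in> pverts G" "gdist G u v = diam G"
proof -
  have "diam G \<in> {gdist G u v | u v. u \<in> pverts G \<and> v \<in> pverts G}"
    unfolding diam_def using nontrivial_connected_graphD(6)[OF assms]
    by (intro Max_in finite_gdists[OF assms]) auto
  then show ?thesis using that by auto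
qed

lemma complete_graph_iff:
  assumes "nontrivial_connected_graph G"
  shows "complete_graph G \<longleftrightarrow> (\<forall>u \<in> pverts G. \<forall>v \<in> pverts G. lazy_adj G u v)"
proof -
  have "complete_graph G \<longleftrightarrow> parcs G = {(u, v). (u, v) \<in> pverts G \<times> pverts G \<and> u \<noteq> v}"
    using nontrivial_connected_graphD(5)[OF assms]
    by (simp add: complete_graph_def complete_digraph_pair_def)
  also have "\<dots> \<longleftrightarrow> (\<forall>u \<in> pverts G. \<forall>v \<in> pverts G. u = v \<or> (u, v) \<in> parcs G)"
    by (auto dest: nontrivial_connected_graphD(1-3)[OF assms])
  finally show ?thesis by (simp add: lazy_adj_def)
qed

text \<open>This expresses the case where the color number is 0 by convention through the diameter,
  so that all cases can be compared by arithmetic.\<close>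

lemma complete_graph_iff_diam:
  assumes "nontrivial_connected_graph G"
  shows "complete_graph G \<longleftrightarrow> diam G \<le> 1"
proof
  obtain u v where "u \<in> pverts G" "v \<in> pverts G" "gdist G u v = diam G"
    using diam_attained[OF assms] .
  then show "complete_graph G \<Longrightarrow> diam G \<le> 1"
    using gdist_le_1_iff[OF assms] by (metis complete_graph_iff[OF assms])
next
  assume "diam G \<le> 1"
  then show "complete_graph G"
    using gdist_le_diam[OF assms] gdist_le_1_iff[OF assms] complete_graph_iff[OF assms] order_trans
    by metis
qed

text \<open>The required vertex precedes \<open>u\<close> on a shortest walk from some other vertex
  \<open>w\<close>.\<close>

lemma ex_neighbour:
  assumes "nontrivial_connected_graph G" "u \<in> pverts G"
  obtains v where "(u, v) \<in> parcs G"
proof -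
  have "\<not> pverts G \<subseteq> {u}"
    using assms card_mono[of "{u}" "pverts G"] by (auto simp: nontrivial_connected_graph_def)
  then obtain w where w: "w \<in> pverts G" "w \<noteq> u" by auto
  then obtain n where "gdist G w u = Suc n"
    using gdist_eq_0_iff[OF assms(1) w(1) assms(2)] by (cases "gdist G w u") auto
  then obtain x where "(x, u) \<in> parcs G" using gdist_pred assms w by metis
  then show ?thesis using that nontrivial_connected_graphD(4)[OF assms(1)] by blast
qed

section \<open>Strong products\<close>

lemma pverts_strong_product [simp]: "pverts (G \<boxtimes> H) = pverts G \<times> pverts H"
  by (simp add: strong_product_def)

text \<open>The three kinds of product edges, together with equality, are the four combinations of
  staying or moving in each factor.\<close>

lemma lazy_adj_strong_product:
  assumes "nontrivial_connected_graph G" "nontrivial_connected_graph H"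
  shows "lazy_adj (G \<boxtimes> H) x y \<longleftrightarrow> lazy_adj G (fst x) (fst y) \<and> lazy_adj H (snd x) (snd y)"
  by (cases x; cases y) (auto simp: lazy_adj_def strong_product_def
      dest: nontrivial_connected_graphD(1-3)[OF assms(1)] nontrivial_connected_graphD(1-3)[OF assms(2)])

lemma lazy_walk_zip:
  assumes "nontrivial_connected_graph G" "nontrivial_connected_graph H"
    "lazy_walk G n g g' p" "lazy_walk H n h h' q"
  shows "lazy_walk (G \<boxtimes> H) n (g, h) (g', h') (zip p q)"
proof -
  have "p \<noteq> []" "q \<noteq> []" "length p = length q" using assms(3,4) by (auto simp: lazy_walk_def)
  then show ?thesis
    using assms(3,4)
    by (auto simp: lazy_walk_def successively_zip lazy_adj_strong_product[OF assms(1,2)] hd_zip last_zip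
        dest: set_zip_leftD set_zip_rightD intro: successively_nth)
qed

lemma lazy_walk_unzip:
  assumes "nontrivial_connected_graph G" "nontrivial_connected_graph H"
    "lazy_walk (G \<boxtimes> H) n x y p"
  shows "lazy_walk G n (fst x) (fst y) (map fst p)" "lazy_walk H n (snd x) (snd y) (map snd p)"
proof -
  have "p \<noteq> []" using assms(3) by (auto simp: lazy_walk_def)
  moreover have "successively (\<lambda>x y. lazy_adj G (fst x) (fst y)) p"
    "successively (\<lambda>x y. lazy_adj H (snd x) (snd y)) p"
    using assms(3) unfolding lazy_walk_def
    by (auto elim!: successively_mono simp: lazy_adj_strong_product[OF assms(1,2)])
  ultimately show "lazy_walk G n (fst x) (fst y) (map fst p)" "lazy_walk H n (snd x) (snd y) (map snd p)"
    using assms(3) by (auto simp: lazy_walk_def successively_map hd_map last_map)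
qed

lemma nontrivial_connected_strong_product:
  assumes G: "nontrivial_connected_graph G" and H: "nontrivial_connected_graph H"
  shows "nontrivial_connected_graph (G \<boxtimes> H)"
proof -
  have pg: "pair_graph (G \<boxtimes> H)"
    using assms by (intro pair_graph_strong_product) (auto simp: nontrivial_connected_graph_def)
  interpret GH: pair_graph "G \<boxtimes> H" by (rule pg)
  have "2 * 2 \<le> card (pverts G) * card (pverts H)"
    using assms by (intro mult_le_mono) (auto simp: nontrivial_connected_graph_def)
  then have card: "2 \<le> card (pverts (G \<boxtimes> H))" by (simp add: card_cartesian_product)
  have reach: "x \<rightarrow>\<^sup>*\<^bsub>G \<boxtimes> H\<^esub> y" if x: "x \<in> pverts (G \<boxtimes> H)" and y: "y \<in> pverts (G \<boxtimes> H)" for x y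
  proof -
    \<comment> \<open>The larger distance is a length for which both factors have a lazy walk, so
      the two walks can be zipped.\<close>
    define n where "n = max (gdist G (fst x) (fst y)) (gdist H (snd x) (snd y))"
    have "\<exists>p. lazy_walk G n (fst x) (fst y) p"
      using x y gdist_le_iff[OF G, of "fst x" "fst y" n] unfolding n_def by auto
    moreover have "\<exists>q. lazy_walk H n (snd x) (snd y) q"
      using x y gdist_le_iff[OF H, of "snd x" "snd y" n] unfolding n_def by auto
    ultimately obtain r where "lazy_walk (G \<boxtimes> H) n x y r"
      using lazy_walk_zip[OF G H] by (metis prod.collapse)
    then obtain q where "q \<in> paths_between (G \<boxtimes> H) x y" using lazy_walk_imp_path by metis
    then show ?thesis using GH.reachable_vpath_conv by (auto simp: paths_between_def)
  qed
  have "Digraph_Component.connected (with_proj (G \<boxtimes> H))"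
    unfolding connected_def strongly_connected_def
    using reach card GH.reachable_mk_symmetric_eq[OF GH.pair_sym_arcs]
      nontrivial_connected_graphD(6)[OF G] nontrivial_connected_graphD(6)[OF H] by auto
  then show ?thesis using pg card by (simp add: nontrivial_connected_graph_def)
qed

text \<open>Zipping and unzipping lazy walks shows that both sides have the same upper bounds
  \<open>n\<close>; taking each side in turn for \<open>n\<close> gives equality.\<close>

lemma gdist_strong_product:
  assumes G: "nontrivial_connected_graph G" and H: "nontrivial_connected_graph H"
    and "g \<in> pverts G" "g' \<in> pverts G" "h \<in> pverts H" "h' \<in> pverts H"
  shows "gdist (G \<boxtimes> H) (g, h) (g', h') = max (gdist G g g') (gdist H h h')"
proof -
  have le: "gdist (G \<boxtimes> H) (g, h) (g', h') \<le> n \<longleftrightarrow> gdist G g g' \<le> n \<and> gdist H h h' \<le> n" for n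
  proof -
    have "gdist (G \<boxtimes> H) (g, h) (g', h') \<le> n \<longleftrightarrow> (\<exists>p. lazy_walk (G \<boxtimes> H) n (g, h) (g', h') p)"
      using assms(3-6) by (intro gdist_le_iff nontrivial_connected_strong_product[OF G H]) auto
    also have "\<dots> \<longleftrightarrow> (\<exists>p. lazy_walk G n g g' p) \<and> (\<exists>q. lazy_walk H n h h' q)"
      using lazy_walk_zip[OF G H, of n g g' _ h h'] lazy_walk_unzip[OF G H, of n "(g, h)" "(g', h')"]
      unfolding fst_conv snd_conv by blast
    also have "\<dots> \<longleftrightarrow> gdist G g g' \<le> n \<and> gdist H h h' \<le> n"
      using gdist_le_iff[OF G assms(3,4), of n] gdist_le_iff[OF H assms(5,6), of n] by blast
    finally show ?thesis .
  qed
  show ?thesis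
    using le[of "max (gdist G g g') (gdist H h h')"] le[of "gdist (G \<boxtimes> H) (g, h) (g', h')"] by auto
qed

text \<open>For the lower bound, a farthest pair of \<open>G\<close> is combined with a farthest
  pair of \<open>H\<close>.\<close>

lemma diam_strong_product:
  assumes G: "nontrivial_connected_graph G" and H: "nontrivial_connected_graph H"
  shows "diam (G \<boxtimes> H) = max (diam G) (diam H)"
proof (rule antisym)
  note GH = nontrivial_connected_strong_product[OF G H]
  obtain x y where "x \<in> pverts (G \<boxtimes> H)" "y \<in> pverts (G \<boxtimes> H)" "gdist (G \<boxtimes> H) x y = diam (G \<boxtimes> H)"
    using diam_attained[OF GH] .
  then show "diam (G \<boxtimes> H) \<le> max (diam G) (diam H)"
    using gdist_strong_product[OF G H, of "fst x" "fst y" "snd x" "snd y"]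
      gdist_le_diam[OF G, of "fst x" "fst y"] gdist_le_diam[OF H, of "snd x" "snd y"]
    by (auto simp: mem_Times_iff)
  obtain g g' where g: "g \<in> pverts G" "g' \<in> pverts G" "gdist G g g' = diam G" using diam_attained[OF G] .
  obtain h h' where h: "h \<in> pverts H" "h' \<in> pverts H" "gdist H h h' = diam H" using diam_attained[OF H] .
  show "max (diam G) (diam H) \<le> diam (G \<boxtimes> H)"
    using gdist_strong_product[OF G H g(1,2) h(1,2)] gdist_le_diam[OF GH, of "(g, h)" "(g', h')"] g h
    by simp
qed

section \<open>Colour counts\<close>

lemma pvc_k_eqI:
  assumes "\<not> (k = 1 \<and> complete_graph G)" "c ` pverts G \<subseteq> {..<n}" "proper_vertex_connected k G c"
    and "\<And>m c. c ` pverts G \<subseteq> {..<m} \<Longrightarrow> proper_vertex_connected k G c \<Longrightarrow> n \<le> m"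
  shows "pvc_k k G = n"
proof -
  have "(LEAST n. \<exists>c. c ` pverts G \<subseteq> {..<n} \<and> proper_vertex_connected k G c) = n"
    by (rule Least_equality) (use assms in blast)+
  then show ?thesis using assms(1) by (auto simp: pvc_k_def)
qed

lemma colours_ge_1:
  assumes "nontrivial_connected_graph G" "c ` pverts G \<subseteq> {..<m::nat}"
  shows "1 \<le> m"
  using nontrivial_connected_graphD(6)[OF assms(1)] assms(2) by (cases m) auto

text \<open>Three edges mean two adjacent internal vertices, which a single color cannot
  separate.\<close>

lemma colours_ge_2:
  assumes G: "nontrivial_connected_graph G" and c: "c ` pverts G \<subseteq> {..<m}"
    and p: "p \<in> paths_between G u v" "vertex_proper c p" "3 \<le> vwalk_length p"
  shows "2 \<le> m"
proof (rule ccontr)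
  assume "\<not> 2 \<le> m"
  then have "m = 1" using colours_ge_1[OF G c] by simp
  then have "length p \<le> 3"
    using c p by (intro vertex_proper_constant_imp_short[of c]) (auto simp: paths_between_iff)
  then show False using p(3) by simp
qed

text \<open>Every path between two vertices at distance \<open>diam G\<close> has at least three
  edges, and \<open>1 \<le> k\<close> supplies one that is vertex-proper.\<close>

lemma colours_ge_2_proper_vertex_connected:
  assumes G: "nontrivial_connected_graph G" and c: "c ` pverts G \<subseteq> {..<m}"
    and d: "3 \<le> diam G" and k: "1 \<le> k" and pc: "proper_vertex_connected k G c"
  shows "2 \<le> m"
proof -
  obtain u v where uv: "u \<in> pverts G" "v \<in> pverts G" "gdist G u v = diam G"
    using diam_attained[OF G] .
  then have "u \<noteq> v" using d gdist_eq_0_iff[OF G, of u v] by auto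
  then obtain P where P: "P \<subseteq> paths_between G u v" "card P = k" "\<forall>p \<in> P. vertex_proper c p"
    using pc uv unfolding proper_vertex_connected_def by blast
  then have "P \<noteq> {}" using k by auto
  then obtain p where "p \<in> P" by blast
  with P have p: "p \<in> paths_between G u v" "vertex_proper c p" by auto
  moreover have "3 \<le> vwalk_length p" using gdist_le_path[OF p(1)] uv(3) d by simp
  ultimately show ?thesis by (rule colours_ge_2[OF G c])
qed

lemma colours_ge_2_strong:
  assumes G: "nontrivial_connected_graph G" and c: "c ` pverts G \<subseteq> {..<m}"
    and d: "3 \<le> diam G" and sc: "strong_proper_vertex_connected G c"
  shows "2 \<le> m"
proof -
  obtain u v where uv: "u \<in> pverts G" "v \<in> pverts G" "gdist G u v = diam G"
    using diam_attained[OF G] .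
  then have "u \<noteq> v" using d gdist_eq_0_iff[OF G, of u v] by auto
  then obtain p where p: "p \<in> geodesics G u v" "vertex_proper c p"
    using sc uv unfolding strong_proper_vertex_connected_def by blast
  then have "p \<in> paths_between G u v" "3 \<le> vwalk_length p" using uv(3) d by (auto simp: geodesics_def)
  then show ?thesis using colours_ge_2[OF G c] p by blast
qed

text \<open>Complete graphs are covered as well: their value is 0.\<close>

lemma spvc_le:
  assumes "c ` pverts G \<subseteq> {..<n}" "strong_proper_vertex_connected G c"
  shows "spvc G \<le> n"
  using assms Least_le[of "\<lambda>n. \<exists>c. c ` pverts G \<subseteq> {..<n} \<and> strong_proper_vertex_connected G c" n]
  by (auto simp: spvc_def)

text \<open>An injective coloring makes every geodesic vertex-proper, so the \<open>LEAST\<close> in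
  \<open>spvc\<close> ranges over a nonempty set and is attained.\<close>

lemma spvc_attained:
  assumes G: "nontrivial_connected_graph G" and nc: "\<not> complete_graph G"
  obtains c where "c ` pverts G \<subseteq> {..<spvc G}" "strong_proper_vertex_connected G c"
proof -
  obtain c where c: "bij_betw c (pverts G) {0..<card (pverts G)}"
    using ex_bij_betw_finite_nat[OF nontrivial_connected_graphD(5)[OF G]] by blast
  have "strong_proper_vertex_connected G c"
    unfolding strong_proper_vertex_connected_def
  proof (intro ballI impI)
    fix u v assume "u \<in> pverts G" "v \<in> pverts G"
    then obtain p where p: "p \<in> geodesics G u v" using ex_geodesic[OF G] by blast
    then have "distinct p" "set p \<subseteq> pverts G" by (auto simp: geodesics_def paths_between_iff)
    then have "distinct (map c p)"
      using c by (auto simp: distinct_map bij_betw_def intro: inj_on_subset)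
    then have "distinct_adj (map c p)"
      by (metis Suc_lessD distinct_adj_conv_nth n_not_Suc_n nth_eq_iff_index_eq)
    then show "\<exists>p \<in> geodesics G u v. vertex_proper c p" using p distinct_adj_imp_vertex_proper by blast
  qed
  moreover have "c ` pverts G \<subseteq> {..<card (pverts G)}" using c by (auto simp: bij_betw_def)
  ultimately have "\<exists>n c. c ` pverts G \<subseteq> {..<n} \<and> strong_proper_vertex_connected G c" by blast
  from LeastI_ex[OF this] show ?thesis using that nc by (auto simp: spvc_def)
qed

lemma spvc_ge_2:
  assumes "nontrivial_connected_graph G" "3 \<le> diam G"
  shows "2 \<le> spvc G"
proof -
  have "\<not> complete_graph G" using assms complete_graph_iff_diam by fastforce
  then show ?thesis using spvc_attained[OF assms(1)] colours_ge_2_strong[OF assms(1) _ assms(2)] by metis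
qed

text \<open>Every geodesic has at most one internal vertex, so the coloring may be
  arbitrary.\<close>

lemma strong_proper_vertex_connected_if_diam_le_2:
  assumes G: "nontrivial_connected_graph G" and d: "diam G \<le> 2"
  shows "strong_proper_vertex_connected G c"
  unfolding strong_proper_vertex_connected_def
proof (intro ballI impI)
  fix u v assume uv: "u \<in> pverts G" "v \<in> pverts G"
  then obtain p where p: "p \<in> geodesics G u v" using ex_geodesic[OF G] by blast
  then have "length p \<le> 3" using gdist_le_diam[OF G uv] d by (auto simp: geodesics_def)
  then show "\<exists>p \<in> geodesics G u v. vertex_proper c p" using p vertex_proper_short by blast
qed

lemma strong_imp_proper_vertex_connected:
  assumes "strong_proper_vertex_connected G c"
  shows "proper_vertex_connected 1 G c"
  unfolding proper_vertex_connected_def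
proof (intro ballI impI)
  fix u v assume "u \<in> pverts G" "v \<in> pverts G" "u \<noteq> v"
  then obtain p where "p \<in> geodesics G u v" "vertex_proper c p"
    using assms unfolding strong_proper_vertex_connected_def by blast
  then show "\<exists>P\<subseteq>paths_between G u v. finite P \<and> card P = 1 \<and> internally_disjoint P \<and> (\<forall>p\<in>P. vertex_proper c p)"
    by (intro exI[of _ "{p}"]) (auto simp: geodesics_def internally_disjoint_def)
qed

lemma proper_vertex_connected_2_imp_1:
  assumes "proper_vertex_connected 2 G c"
  shows "proper_vertex_connected 1 G c"
  unfolding proper_vertex_connected_def
proof (intro ballI impI)
  fix u v assume "u \<in> pverts G" "v \<in> pverts G" "u \<noteq> v"
  then obtain P where "P \<subseteq> paths_between G u v" "card P = 2" "\<forall>p \<in> P. vertex_proper c p"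
    using assms unfolding proper_vertex_connected_def by blast
  moreover then obtain p where "p \<in> P" by fastforce
  ultimately show "\<exists>P\<subseteq>paths_between G u v. finite P \<and> card P = 1 \<and> internally_disjoint P \<and> (\<forall>p\<in>P. vertex_proper c p)"
    by (intro exI[of _ "{p}"]) (auto simp: internally_disjoint_def)
qed

lemma pvc_eq_1:
  assumes "nontrivial_connected_graph G" "diam G = 2"
  shows "pvc G = 1"
proof (rule pvc_k_eqI[where c = "\<lambda>_. 0"])
  show "\<not> (1 = (1::nat) \<and> complete_graph G)" using assms complete_graph_iff_diam by fastforce
  show "proper_vertex_connected 1 G (\<lambda>_. 0)"
    using assms by (intro strong_imp_proper_vertex_connected strong_proper_vertex_connected_if_diam_le_2) auto
qed (use colours_ge_1[OF assms(1)] in auto)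

lemma spvc_eq_1:
  assumes "nontrivial_connected_graph G" "diam G = 2"
  shows "spvc G = 1"
proof (rule antisym)
  show "spvc G \<le> 1"
    using assms by (intro spvc_le[where c = "\<lambda>_. 0"] strong_proper_vertex_connected_if_diam_le_2) auto
  have "\<not> complete_graph G" using assms complete_graph_iff_diam by fastforce
  then show "1 \<le> spvc G" using spvc_attained[OF assms(1)] colours_ge_1[OF assms(1)] by metis
qed

section \<open>Lifting geodesics to strong products\<close>

text \<open>One coordinate without repetitions suffices to make the zipped walk repetition-free; its
  lazy steps are then true edges, and its length \<open>n\<close> is the distance in the
  product.\<close>

lemma zip_in_geodesics:
  assumes G: "nontrivial_connected_graph G" and H: "nontrivial_connected_graph H"
    and p: "lazy_walk G n g g' p" and q: "lazy_walk H n h h' q" and pq: "distinct p \<or> distinct q"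
    and n: "n = max (gdist G g g') (gdist H h h')"
  shows "zip p q \<in> geodesics (G \<boxtimes> H) (g, h) (g', h')"
proof -
  note GH = nontrivial_connected_strong_product[OF G H]
  have len: "length p = Suc n" "length q = Suc n" using p q by (auto simp: lazy_walk_def)
  have dist: "distinct (zip p q)" using pq by (auto intro: distinct_zipI1 distinct_zipI2)
  have lw: "lazy_walk (G \<boxtimes> H) n (g, h) (g', h') (zip p q)" by (rule lazy_walk_zip[OF G H p q])
  have "g \<in> pverts G" "g' \<in> pverts G" "h \<in> pverts H" "h' \<in> pverts H"
    using lazy_walk_ends[OF p] lazy_walk_ends[OF q] by auto
  then have gd: "gdist (G \<boxtimes> H) (g, h) (g', h') = n" using n by (simp add: gdist_strong_product[OF G H])
  have "successively (\<lambda>x y. (x, y) \<in> parcs (G \<boxtimes> H)) (zip p q)"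
    unfolding successively_conv_nth
  proof (intro allI impI)
    fix i assume i: "Suc i < length (zip p q)"
    then have "lazy_adj (G \<boxtimes> H) (zip p q ! i) (zip p q ! Suc i)"
      using lw unfolding lazy_walk_def by (blast intro: successively_nth)
    moreover have "zip p q ! i \<noteq> zip p q ! Suc i"
      using i dist nth_eq_iff_index_eq[OF dist, of i "Suc i"] by auto
    ultimately show "(zip p q ! i, zip p q ! Suc i) \<in> parcs (G \<boxtimes> H)" by (simp add: arc_iff_lazy_adj[OF GH])
  qed
  then have "zip p q \<in> paths_between (G \<boxtimes> H) (g, h) (g', h')"
    using lw dist len by (auto simp: paths_between_iff lazy_walk_def)
  then show ?thesis using len gd by (simp add: geodesics_def)
qed

text \<open>The bound on distances gives a lazy walk in \<open>H\<close> with as many steps as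
  \<open>p\<close>, and the two are zipped. That \<open>p\<close> is recovered as
  \<open>map fst q\<close> transfers vertex-properness to \<open>q\<close>.\<close>

lemma ex_geodesic_lift_fst:
  assumes G: "nontrivial_connected_graph G" and H: "nontrivial_connected_graph H"
    and "h \<in> pverts H" "h' \<in> pverts H" "p \<in> geodesics G g g'" "gdist H h h' \<le> gdist G g g'"
  obtains q where "q \<in> geodesics (G \<boxtimes> H) (g, h) (g', h')" "map fst q = p"
proof -
  have p: "lazy_walk G (gdist G g g') g g' p" "distinct p"
    using assms(5) lazy_walk_path[of p G g g'] by (auto simp: geodesics_def paths_between_iff)
  moreover obtain q where q: "lazy_walk H (gdist G g g') h h' q" using gdist_le_iff[OF H] assms by blast
  ultimately have "zip p q \<in> geodesics (G \<boxtimes> H) (g, h) (g', h')"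
    using assms(6) by (intro zip_in_geodesics[OF G H]) auto
  moreover have "length p = length q" using p q by (auto simp: lazy_walk_def)
  ultimately show ?thesis using that by simp
qed

lemma ex_geodesic_lift_snd:
  assumes G: "nontrivial_connected_graph G" and H: "nontrivial_connected_graph H"
    and "g \<in> pverts G" "g' \<in> pverts G" "p \<in> geodesics H h h'" "gdist G g g' \<le> gdist H h h'"
  obtains q where "q \<in> geodesics (G \<boxtimes> H) (g, h) (g', h')" "map snd q = p"
proof -
  have p: "lazy_walk H (gdist H h h') h h' p" "distinct p"
    using assms(5) lazy_walk_path[of p H h h'] by (auto simp: geodesics_def paths_between_iff)
  moreover obtain q where q: "lazy_walk G (gdist H h h') g g' q" using gdist_le_iff[OF G] assms by blast
  ultimately have "zip q p \<in> geodesics (G \<boxtimes> H) (g, h) (g', h')"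
    using assms(6) by (intro zip_in_geodesics[OF G H]) auto
  moreover have "length p = length q" using p q by (auto simp: lazy_walk_def)
  ultimately show ?thesis using that by simp
qed

text \<open>An optimal coloring of \<open>H\<close> is applied to the second coordinate.\<close>

lemma spvc_strong_product_le_snd:
  assumes G: "nontrivial_connected_graph G" and H: "nontrivial_connected_graph H"
    and dG: "diam G \<le> 2" and dH: "3 \<le> diam H"
  shows "spvc (G \<boxtimes> H) \<le> spvc H"
proof -
  have "\<not> complete_graph H" using dH complete_graph_iff_diam[OF H] by simp
  then obtain c where c: "c ` pverts H \<subseteq> {..<spvc H}" "strong_proper_vertex_connected H c"
    using spvc_attained[OF H] by blast
  have "strong_proper_vertex_connected (G \<boxtimes> H) (c \<circ> snd)"
    unfolding strong_proper_vertex_connected_def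
  proof (intro ballI impI)
    fix x y assume "x \<in> pverts (G \<boxtimes> H)" "y \<in> pverts (G \<boxtimes> H)"
    then obtain g h g' h' where xy: "x = (g, h)" "y = (g', h')"
      and V: "g \<in> pverts G" "g' \<in> pverts G" "h \<in> pverts H" "h' \<in> pverts H" by auto
    have le: "gdist G g g' \<le> 2" using gdist_le_diam[OF G V(1,2)] dG by simp
    show "\<exists>p \<in> geodesics (G \<boxtimes> H) x y. vertex_proper (c \<circ> snd) p"
    \<comment> \<open>From 2 on, the distance in \<open>H\<close> is at least the one in
      \<open>G\<close>, so a geodesic of \<open>H\<close> lifts. Below 2, the product distance is at
      most 2 and any geodesic is vertex-proper.\<close>
    proof (cases "2 \<le> gdist H h h'")
      case True
      then have "h \<noteq> h'" using gdist_eq_0_iff[OF H V(3,4)] by auto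
      then obtain p where p: "p \<in> geodesics H h h'" "vertex_proper c p"
        using c V unfolding strong_proper_vertex_connected_def by blast
      obtain q where "q \<in> geodesics (G \<boxtimes> H) x y" "map snd q = p"
        using ex_geodesic_lift_snd[OF G H V(1,2) p(1)] True le xy by auto
      then show ?thesis using p vertex_proper_map[of c snd q] by auto
    next
      case False
      have V': "x \<in> pverts (G \<boxtimes> H)" "y \<in> pverts (G \<boxtimes> H)" using V xy by auto
      obtain p where p: "p \<in> geodesics (G \<boxtimes> H) x y"
        using ex_geodesic[OF nontrivial_connected_strong_product[OF G H] V'] .
      then have "length p \<le> 3"
        using False le gdist_strong_product[OF G H V] xy by (auto simp: geodesics_def)
      then show ?thesis using p vertex_proper_short by blast
    qed
  qed
  moreover have "(c \<circ> snd) ` pverts (G \<boxtimes> H) \<subseteq> {..<spvc H}" using c(1) by auto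
  ultimately show ?thesis by (intro spvc_le)
qed

text \<open>A vertex is colored by the pair of its colors in the factors. A vertex-proper geodesic
  of the factor with the larger distance lifts, and the pair coloring refines the coloring of that
  factor.\<close>

lemma spvc_strong_product_le_mult:
  assumes G: "nontrivial_connected_graph G" and H: "nontrivial_connected_graph H"
    and nG: "\<not> complete_graph G" and nH: "\<not> complete_graph H"
  shows "spvc (G \<boxtimes> H) \<le> spvc G * spvc H"
proof -
  obtain a where a: "a ` pverts G \<subseteq> {..<spvc G}" "strong_proper_vertex_connected G a"
    using spvc_attained[OF G nG] .
  obtain b where b: "b ` pverts H \<subseteq> {..<spvc H}" "strong_proper_vertex_connected H b"
    using spvc_attained[OF H nH] .
  \<comment> \<open>The pair of colors becomes a two-digit number in base \<open>spvc H\<close>;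
    \<open>div\<close> and \<open>mod\<close> recover the digits because
    \<open>b y < spvc H\<close>.\<close>
  define c where "c = (\<lambda>(x, y). a x * spvc H + b y)"
  have bH: "b y < spvc H" if "y \<in> pverts H" for y using b that by auto
  have c_eq: "a x = a x' \<and> b y = b y'"
    if "y \<in> pverts H" "y' \<in> pverts H" "c (x, y) = c (x', y')" for x x' y y'
  proof -
    have "c (x, y) div spvc H = a x" "c (x, y) mod spvc H = b y"
      "c (x', y') div spvc H = a x'" "c (x', y') mod spvc H = b y'"
      using bH[OF that(1)] bH[OF that(2)] by (auto simp: c_def)
    then show ?thesis using that(3) by simp
  qed
  have "c (x, y) < spvc G * spvc H" if "x \<in> pverts G" "y \<in> pverts H" for x y
  proof -
    have "Suc (a x) \<le> spvc G" using a that by auto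
    then have "Suc (a x) * spvc H \<le> spvc G * spvc H" by (rule mult_le_mono1)
    then show ?thesis using bH[OF that(2)] by (simp add: c_def)
  qed
  then have "c ` pverts (G \<boxtimes> H) \<subseteq> {..<spvc G * spvc H}" by auto
  moreover have "strong_proper_vertex_connected (G \<boxtimes> H) c"
    unfolding strong_proper_vertex_connected_def
  proof (intro ballI impI)
    fix x y assume "x \<in> pverts (G \<boxtimes> H)" "y \<in> pverts (G \<boxtimes> H)" and ne: "x \<noteq> y"
    then obtain g h g' h' where xy: "x = (g, h)" "y = (g', h')"
      and V: "g \<in> pverts G" "g' \<in> pverts G" "h \<in> pverts H" "h' \<in> pverts H" by auto
    have pos: "gdist G g g' \<noteq> 0 \<or> gdist H h h' \<noteq> 0"
      using ne xy gdist_eq_0_iff[OF G V(1,2)] gdist_eq_0_iff[OF H V(3,4)] by auto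
    obtain q where q: "q \<in> geodesics (G \<boxtimes> H) x y" "vertex_proper (a \<circ> fst) q \<or> vertex_proper (b \<circ> snd) q"
    proof (cases "gdist H h h' \<le> gdist G g g'")
      case True
      then have "g \<noteq> g'" using pos gdist_eq_0_iff[OF G V(1,2)] by auto
      then obtain p where p: "p \<in> geodesics G g g'" "vertex_proper a p"
        using a V unfolding strong_proper_vertex_connected_def by blast
      obtain q where "q \<in> geodesics (G \<boxtimes> H) x y" "map fst q = p"
        using ex_geodesic_lift_fst[OF G H V(3,4) p(1)] True xy by auto
      then show ?thesis using that p vertex_proper_map[of a fst q] by auto
    next
      case False
      then have "h \<noteq> h'" using gdist_eq_0_iff[OF H V(3,4)] by auto
      then obtain p where p: "p \<in> geodesics H h h'" "vertex_proper b p"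
        using b V unfolding strong_proper_vertex_connected_def by blast
      obtain q where "q \<in> geodesics (G \<boxtimes> H) x y" "map snd q = p"
        using ex_geodesic_lift_snd[OF G H V(1,2) p(1)] False xy by auto
      then show ?thesis using that p vertex_proper_map[of b snd q] by auto
    qed
    have "set q \<subseteq> pverts G \<times> pverts H" using q(1) by (auto simp: geodesics_def paths_between_iff)
    then have "(a \<circ> fst) z = (a \<circ> fst) z' \<and> (b \<circ> snd) z = (b \<circ> snd) z'"
      if "z \<in> set q" "z' \<in> set q" "c z = c z'" for z z'
    proof -
      have "snd z \<in> pverts H" "snd z' \<in> pverts H"
        using \<open>set q \<subseteq> pverts G \<times> pverts H\<close> that(1,2) by auto
      then show ?thesis using c_eq[of "snd z" "snd z'" "fst z" "fst z'"] that(3) by simp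
    qed
    then have "vertex_proper c q"
      using q(2) vertex_proper_coarser[of "a \<circ> fst" q c] vertex_proper_coarser[of "b \<circ> snd" q c] by blast
    then show "\<exists>p \<in> geodesics (G \<boxtimes> H) x y. vertex_proper c p" using q(1) by blast
  qed
  ultimately show ?thesis by (rule spvc_le)
qed

section \<open>Path graphs\<close>

definition path_graph :: "nat \<Rightarrow> nat pair_pre_digraph" where
  "path_graph n = \<lparr> pverts = {..<n}, parcs = {(i, j). i < n \<and> j < n \<and> (j = Suc i \<or> i = Suc j)} \<rparr>"

lemma nontrivial_connected_path_graph:
  assumes "2 \<le> n"
  shows "nontrivial_connected_graph (path_graph n)"
proof -
  have "finite (parcs (path_graph n))"
    by (rule finite_subset[of _ "{..<n} \<times> {..<n}"]) (auto simp: path_graph_def)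
  then have pg: "pair_graph (path_graph n)"
    by unfold_locales (auto simp: path_graph_def symmetric_def sym_def)
  interpret pair_graph "path_graph n" by (rule pg)
  have up: "0 \<rightarrow>\<^sup>*\<^bsub>path_graph n\<^esub> i" if "i < n" for i
    using that
  proof (induction i)
    case 0
    then show ?case by (intro reachable_refl) (simp add: path_graph_def)
  next
    case (Suc i)
    then have "(i, Suc i) \<in> parcs (path_graph n)" by (auto simp: path_graph_def)
    with Suc show ?case by (meson Suc_lessD reachable_adj_trans)
  qed
  have "i \<rightarrow>\<^sup>*\<^bsub>path_graph n\<^esub> j" if "i < n" "j < n" for i j
    using up[OF that(1)] up[OF that(2)] symmetric_reachable[OF pair_sym_arcs] reachable_trans by blast
  then have "Digraph_Component.connected (with_proj (path_graph n))"
    unfolding connected_def strongly_connected_def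
    using assms reachable_mk_symmetric_eq[OF pair_sym_arcs]
    by (auto simp: path_graph_def lessThan_empty_iff)
  then show ?thesis using pg assms by (simp add: nontrivial_connected_graph_def path_graph_def)
qed

text \<open>Each step climbs by at most one. In a path graph this bounds the number of edges of a
  path from below.\<close>

lemma last_le_hd_plus_length:
  "successively (\<lambda>i j. j \<le> Suc i) p \<Longrightarrow> p \<noteq> [] \<Longrightarrow> last p \<le> hd p + (length p - 1)"
  by (induction p rule: induct_list012) auto

lemma diam_path_graph_ge:
  assumes "2 \<le> n"
  shows "n - 1 \<le> diam (path_graph n)"
proof -
  note P = nontrivial_connected_path_graph[OF assms]
  have V: "0 \<in> pverts (path_graph n)" "n - 1 \<in> pverts (path_graph n)" using assms by (auto simp: path_graph_def)
  obtain p where "p \<in> geodesics (path_graph n) 0 (n - 1)" using ex_geodesic[OF P V] .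
  then have p: "p \<noteq> []" "successively (\<lambda>x y. (x, y) \<in> parcs (path_graph n)) p" "hd p = 0" "last p = n - 1"
    "length p - 1 = gdist (path_graph n) 0 (n - 1)"
    by (auto simp: geodesics_def paths_between_iff)
  have "successively (\<lambda>i j. j \<le> Suc i) p"
    using p(2) by (rule successively_mono) (auto simp: path_graph_def)
  then have "n - 1 \<le> gdist (path_graph n) 0 (n - 1)" using last_le_hd_plus_length p by fastforce
  also have "\<dots> \<le> diam (path_graph n)" by (rule gdist_le_diam[OF P V])
  finally show ?thesis .
qed

text \<open>Neighbors are consecutive integers, so parity alternates along every geodesic.\<close>

lemma spvc_path_graph_le:
  assumes "2 \<le> n"
  shows "spvc (path_graph n) \<le> 2"
proof (rule spvc_le[where c = "\<lambda>i. i mod 2"])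
  show "strong_proper_vertex_connected (path_graph n) (\<lambda>i. i mod 2)"
    unfolding strong_proper_vertex_connected_def
  proof (intro ballI impI)
    fix i j assume "i \<in> pverts (path_graph n)" "j \<in> pverts (path_graph n)"
    then obtain p where p: "p \<in> geodesics (path_graph n) i j"
      using ex_geodesic[OF nontrivial_connected_path_graph[OF assms]] by blast
    then have "successively (\<lambda>x y. (x, y) \<in> parcs (path_graph n)) p"
      by (auto simp: geodesics_def paths_between_iff)
    then have "distinct_adj (map (\<lambda>i. i mod 2) p)"
      unfolding distinct_adj_def successively_map
      by (rule successively_mono) (auto simp: path_graph_def, presburger+)
    then show "\<exists>p \<in> geodesics (path_graph n) i j. vertex_proper (\<lambda>i. i mod 2) p"
      using p distinct_adj_imp_vertex_proper by blast
  qed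
qed auto

lemma diam_path_graph_2_le: "diam (path_graph 2) \<le> 1"
proof -
  have "complete_graph (path_graph 2)"
    unfolding complete_graph_def complete_digraph_pair_def path_graph_def by (auto simp: less_2_cases_iff)
  then show ?thesis using complete_graph_iff_diam nontrivial_connected_path_graph by blast
qed

text \<open>The witnesses are a single edge and the path on four vertices. The reverse inequality
  goes through 2: parity colors the path with two colors, while the product has diameter at least 3
  and needs two.\<close>

lemma spvc_strong_product_sharp:
  "spvc (path_graph 2 \<boxtimes> path_graph 4) = spvc (path_graph 4)"
proof (rule antisym)
  have G: "nontrivial_connected_graph (path_graph 2)" and H: "nontrivial_connected_graph (path_graph 4)"
    by (auto intro: nontrivial_connected_path_graph)
  have d: "diam (path_graph 2) \<le> 2" "3 \<le> diam (path_graph 4)"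
    using diam_path_graph_2_le diam_path_graph_ge[of 4] by auto
  show "spvc (path_graph 2 \<boxtimes> path_graph 4) \<le> spvc (path_graph 4)"
    by (rule spvc_strong_product_le_snd[OF G H d])
  have "spvc (path_graph 4) \<le> 2" by (rule spvc_path_graph_le) simp
  also have "2 \<le> spvc (path_graph 2 \<boxtimes> path_graph 4)"
    using d(2) by (intro spvc_ge_2 nontrivial_connected_strong_product[OF G H])
      (simp add: diam_strong_product[OF G H])
  finally show "spvc (path_graph 4) \<le> spvc (path_graph 2 \<boxtimes> path_graph 4)" .
qed

section \<open>Two disjoint paths\<close>

lemma ex_two_disjoint_paths:
  assumes "p \<in> paths_between G u v" "q \<in> paths_between G u v" "p \<noteq> q" "set p \<inter> set q \<subseteq> {u, v}"
    "vertex_proper c p" "vertex_proper c q"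
  shows "\<exists>P\<subseteq>paths_between G u v. finite P \<and> card P = 2 \<and> internally_disjoint P \<and> (\<forall>p\<in>P. vertex_proper c p)"
proof -
  have "set (internal_verts p) = set p - {u, v}" "set (internal_verts q) = set q - {u, v}"
    using assms(1,2) set_internal_verts[of p] set_internal_verts[of q] by (auto simp: paths_between_iff)
  then have "internally_disjoint {p, q}" using assms(4) by (auto simp: internally_disjoint_def)
  then show ?thesis using assms by (intro exI[of _ "{p, q}"]) auto
qed

text \<open>The color is the parity of the distance to a root \<open>r\<close>. Moving to a vertex
  one step closer to \<open>r\<close> flips it, so every vertex is joined to \<open>r\<close> by
  color-changing edges in both directions. A walk through \<open>r\<close> is then shortened to a
  path.\<close>

lemma alternating_colouring:
  fixes G :: "'a pair_pre_digraph"
  assumes G: "nontrivial_connected_graph G"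
  shows "\<exists>a :: 'a \<Rightarrow> nat. (\<forall>u. a u < 2) \<and>
    (\<forall>u \<in> pverts G. \<forall>v \<in> pverts G. \<exists>p \<in> paths_between G u v. distinct_adj (map a p))"
proof -
  obtain r where r: "r \<in> pverts G" using nontrivial_connected_graphD(6)[OF G] by blast
  define a where "a = (\<lambda>v. gdist G r v mod 2)"
  \<comment> \<open>Other arcs of \<open>G\<close> may join vertices of equal color; only those that
    change the color are kept.\<close>
  define R where "R = (\<lambda>u v. (u, v) \<in> parcs G \<and> a u \<noteq> a v)"
  have to_r: "R\<^sup>*\<^sup>* r v \<and> R\<^sup>*\<^sup>* v r" if "v \<in> pverts G" "gdist G r v = n" for v n
    using that
  proof (induction n arbitrary: v)
    case 0
    then show ?case using gdist_eq_0_iff[OF G r, of v] by auto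
  next
    case (Suc n)
    then obtain w where w: "gdist G r w = n" "(w, v) \<in> parcs G" using gdist_pred[OF G r] by metis
    then have "R\<^sup>*\<^sup>* r w \<and> R\<^sup>*\<^sup>* w r" using Suc.IH nontrivial_connected_graphD(1)[OF G] by blast
    moreover have "a w \<noteq> a v" using w Suc.prems by (simp add: a_def mod_Suc)
    then have "R w v" "R v w" using w nontrivial_connected_graphD(4)[OF G] by (auto simp: R_def)
    ultimately show ?case by (meson converse_rtranclp_into_rtranclp rtranclp.rtrancl_into_rtrancl)
  qed
  have "\<exists>p \<in> paths_between G u v. distinct_adj (map a p)" if uv: "u \<in> pverts G" "v \<in> pverts G" for u v
  proof -
    have "R\<^sup>*\<^sup>* u v" using to_r uv by (meson rtranclp_trans)
    from rtranclp_imp_successively[OF this] obtain p where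
      p: "p \<noteq> []" "successively R p" "hd p = u" "last p = v" by blast
    have "successively (\<lambda>x y. x = y \<or> R x y) p" using p(2) by (rule successively_mono) auto
    then obtain q where q: "q \<noteq> []" "distinct q" "successively R q" "set q \<subseteq> set p"
      "hd q = hd p" "last q = last p" "length q \<le> length p"
      using p(1) by (rule successively_imp_distinct)
    have "successively (\<lambda>x y. (x, y) \<in> parcs G) q" "distinct_adj (map a q)"
      using q(3) unfolding distinct_adj_def successively_map by (auto elim!: successively_mono simp: R_def)
    moreover have "set q \<subseteq> pverts G" if "successively (\<lambda>x y. (x, y) \<in> parcs G) q" "hd q \<in> pverts G" "q \<noteq> []" for q
      using that
    proof (induction q rule: induct_list012)
      case (3 x y zs)
      then show ?case using nontrivial_connected_graphD(2)[OF G] by auto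
    qed auto
    ultimately show ?thesis using q p uv by (intro bexI[of _ q]) (auto simp: paths_between_iff)
  qed
  moreover have "a u < 2" for u by (simp add: a_def)
  ultimately show ?thesis by blast
qed

text \<open>Stronger than \<open>vertex_proper\<close>: the end vertices have to alternate as well,
  which is what allows gluing at a common end.\<close>

definition alternating_path ::
    "'a pair_pre_digraph \<Rightarrow> ('a \<Rightarrow> nat) \<Rightarrow> 'a \<Rightarrow> 'a \<Rightarrow> 'a list \<Rightarrow> bool" where
  "alternating_path G c u v p \<longleftrightarrow> p \<in> paths_between G u v \<and> distinct_adj (map c p)"

lemma alternating_pathD:
  assumes "alternating_path G c u v p"
  shows "u \<in> set p" "v \<in> set p" "set p \<subseteq> pverts G" "p \<noteq> []" "hd p = u" "last p = v" "distinct p"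
    "vertex_proper c p" "p \<in> paths_between G u v"
  using assms distinct_adj_imp_vertex_proper[of c p] by (auto simp: alternating_path_def paths_between_iff)

lemma alternating_path_edge:
  assumes "u \<in> pverts G" "v \<in> pverts G" "u \<noteq> v" "(u, v) \<in> parcs G" "c u \<noteq> c v"
  shows "alternating_path G c u v [u, v]"
  using assms by (auto simp: alternating_path_def paths_between_iff)

text \<open>The shared vertex \<open>v\<close> is dropped from the second path. At the junction, the
  edge and the color change are those of the first step of \<open>q\<close>.\<close>

lemma alternating_path_append:
  assumes p: "alternating_path G c u v p" and q: "alternating_path G c v w q"
    and pq: "set p \<inter> set q \<subseteq> {v}"
  obtains r where "alternating_path G c u w r" "set r = set p \<union> set q"
proof -
  obtain q' where q': "q = v # q'" using alternating_pathD(4,5)[OF q] by (cases q) auto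
  have p': "p \<noteq> []" "hd p = u" "last p = v" "v \<in> set p" using alternating_pathD[OF p] by auto
  have "v \<notin> set q'" using alternating_pathD(7)[OF q] q' by auto
  then have "set p \<inter> set q' = {}" using pq q' by auto
  moreover have "distinct_adj (map c (p @ q'))"
    using p q q' p' by (cases q')
      (auto simp: alternating_path_def distinct_adj_append_iff last_map)
  ultimately have "alternating_path G c u w (p @ q')"
    using p q q' p' by (auto simp: alternating_path_def paths_between_iff successively_append_iff
        successively_Cons)
  moreover have "set (p @ q') = set p \<union> set q" using q' p' by auto
  ultimately show ?thesis by (rule that)
qed

text \<open>The last assumption ensures \<open>p \<noteq> q\<close>: equal paths would have exactly
  the vertices \<open>u\<close> and \<open>v\<close>.\<close>

lemma ex_two_disjoint_alternating_paths:
  assumes "alternating_path G c u v p" "alternating_path G c u v q" "set p \<inter> set q = {u, v}"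
    and "\<not> set q \<subseteq> {u, v}"
  shows "\<exists>P\<subseteq>paths_between G u v. finite P \<and> card P = 2 \<and> internally_disjoint P \<and> (\<forall>p\<in>P. vertex_proper c p)"
proof -
  have "p \<noteq> q" using assms(3,4) by auto
  then show ?thesis
    using assms(3) alternating_pathD(8,9)[OF assms(1)] alternating_pathD(8,9)[OF assms(2)]
    by (intro ex_two_disjoint_paths[of p _ _ _ q]) simp_all
qed

text \<open>The second path makes a detour from \<open>u\<close> to \<open>u'\<close>, along a copy of the first one, and
  back from \<open>v'\<close> to \<open>v\<close>.\<close>

lemma ex_two_disjoint_paths_rails:
  assumes K: "nontrivial_connected_graph K"
    and p: "alternating_path K c u v p" and q: "alternating_path K c u' v' q"
    and disj: "set p \<inter> set q = {}"
    and e: "(u, u') \<in> parcs K" "c u \<noteq> c u'" "(v', v) \<in> parcs K" "c v' \<noteq> c v" and ne: "u \<noteq> v"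
  shows "\<exists>P\<subseteq>paths_between K u v. finite P \<and> card P = 2 \<and> internally_disjoint P \<and> (\<forall>p\<in>P. vertex_proper c p)"
proof -
  note D = nontrivial_connected_graphD[OF K]
  have uu: "alternating_path K c u u' [u, u']" and vv: "alternating_path K c v' v [v', v]"
    using e D(1-3) by (auto intro!: alternating_path_edge)
  have in_sets: "u \<notin> set q" "v \<notin> set q" "u' \<in> set q" "v' \<in> set q" "u' \<notin> set p" "v' \<notin> set p"
    using disj alternating_pathD(1,2)[OF p] alternating_pathD(1,2)[OF q] by auto
  obtain r where r: "alternating_path K c u v' r" "set r = {u, u'} \<union> set q"
    using alternating_path_append[OF uu q] in_sets by auto
  have "set r \<inter> set [v', v] \<subseteq> {v'}" using r(2) in_sets ne by auto
  then obtain s where s: "alternating_path K c u v s" "set s = set r \<union> set [v', v]"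
    using alternating_path_append[OF r(1) vv] by metis
  have "set p \<inter> set s = {u, v}" "\<not> set s \<subseteq> {u, v}"
    using s(2) r(2) in_sets disj alternating_pathD(1,2)[OF p] by auto
  then show ?thesis using ex_two_disjoint_alternating_paths[OF p s(1)] by blast
qed

text \<open>With the sum of both parities as color, a move along a row changes color exactly when
  \<open>a\<close> does, and a move along a column exactly when \<open>b\<close> does. Copies of
  alternating paths of the factors thus alternate in the product.\<close>

lemma two_colours_proper_2_connected:
  fixes G :: "'a pair_pre_digraph" and H :: "'b pair_pre_digraph"
  assumes G: "nontrivial_connected_graph G" and H: "nontrivial_connected_graph H"
  obtains c where "c ` pverts (G \<boxtimes> H) \<subseteq> {..<2}" "proper_vertex_connected 2 (G \<boxtimes> H) c"
proof -
  note GH = nontrivial_connected_strong_product[OF G H]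
  obtain a :: "'a \<Rightarrow> nat" where a: "\<And>u v. u \<in> pverts G \<Longrightarrow> v \<in> pverts G \<Longrightarrow> \<exists>p \<in> paths_between G u v. distinct_adj (map a p)"
    "\<And>u. a u < 2"
    using alternating_colouring[OF G] by blast
  obtain b :: "'b \<Rightarrow> nat" where b: "\<And>u v. u \<in> pverts H \<Longrightarrow> v \<in> pverts H \<Longrightarrow> \<exists>p \<in> paths_between H u v. distinct_adj (map b p)"
    "\<And>u. b u < 2"
    using alternating_colouring[OF H] by blast
  define c where "c = (\<lambda>(x, y). (a x + b y) mod 2)"
  have mod_a: "(a x + k) mod 2 = (a x' + k) mod 2 \<longleftrightarrow> a x = a x'" for x x' k
    using a(2)[of x] a(2)[of x'] by presburger
  have mod_b: "(k + b y) mod 2 = (k + b y') mod 2 \<longleftrightarrow> b y = b y'" for y y' k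
    using b(2)[of y] b(2)[of y'] by presburger
  have c_row: "c (x, y) = c (x', y) \<longleftrightarrow> a x = a x'" for x x' y by (simp add: c_def mod_a)
  have c_col: "c (x, y) = c (x, y') \<longleftrightarrow> b y = b y'" for x y y' by (simp add: c_def mod_b)
  have row: "alternating_path (G \<boxtimes> H) c (g, y) (g', y) (map (\<lambda>x. (x, y)) p)"
    if "alternating_path G a g g' p" "y \<in> pverts H" for g g' p y
  proof -
    have "successively (\<lambda>u v. (u, v) \<in> parcs G) p" using that(1) by (auto simp: alternating_path_def paths_between_iff)
    then have "successively (\<lambda>u v. (u, v) \<in> parcs (G \<boxtimes> H)) (map (\<lambda>x. (x, y)) p)"
      unfolding successively_map by (rule successively_mono) (use that(2) in \<open>simp add: strong_product_def\<close>)
    then show ?thesis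
      using that by (auto simp: alternating_path_def paths_between_iff distinct_adj_def successively_map c_row
          hd_map last_map distinct_map inj_on_def)
  qed
  have col: "alternating_path (G \<boxtimes> H) c (x, h) (x, h') (map (\<lambda>y. (x, y)) q)"
    if "alternating_path H b h h' q" "x \<in> pverts G" for h h' q x
  proof -
    have "successively (\<lambda>u v. (u, v) \<in> parcs H) q" using that(1) by (auto simp: alternating_path_def paths_between_iff)
    then have "successively (\<lambda>u v. (u, v) \<in> parcs (G \<boxtimes> H)) (map (\<lambda>y. (x, y)) q)"
      unfolding successively_map by (rule successively_mono) (use that(2) in \<open>simp add: strong_product_def\<close>)
    then show ?thesis
      using that by (auto simp: alternating_path_def paths_between_iff distinct_adj_def successively_map c_col
          hd_map last_map distinct_map inj_on_def)
  qed
  have exG: "\<exists>p. alternating_path G a g g' p" if "g \<in> pverts G" "g' \<in> pverts G" for g g'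
    using a(1)[OF that] by (auto simp: alternating_path_def)
  have exH: "\<exists>q. alternating_path H b h h' q" if "h \<in> pverts H" "h' \<in> pverts H" for h h'
    using b(1)[OF that] by (auto simp: alternating_path_def)
  \<comment> \<open>An arbitrary neighbor may have the color of \<open>u\<close>; the second vertex
    of an alternating path from \<open>u\<close> to that neighbor does not. It selects the parallel
    row or column for the detour.\<close>
  have nbr: "\<exists>w. (u, w) \<in> parcs K \<and> k u \<noteq> k w"
    if K: "nontrivial_connected_graph K" and u: "u \<in> pverts K"
      and ex: "\<And>v. v \<in> pverts K \<Longrightarrow> \<exists>p. alternating_path K k u v p" for K :: "'c pair_pre_digraph" and k u
  proof -
    obtain v where v: "(u, v) \<in> parcs K" using ex_neighbour[OF K u] .
    then have "v \<in> pverts K" "u \<noteq> v" using nontrivial_connected_graphD(2,3)[OF K] by blast+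
    then obtain p where "alternating_path K k u v p" using ex by blast
    with \<open>u \<noteq> v\<close> show ?thesis
      by (cases p; cases "tl p") (auto simp: alternating_path_def paths_between_iff)
  qed
  have "proper_vertex_connected 2 (G \<boxtimes> H) c"
    unfolding proper_vertex_connected_def
  proof (intro ballI impI)
    fix x y assume "x \<in> pverts (G \<boxtimes> H)" "y \<in> pverts (G \<boxtimes> H)" and ne: "x \<noteq> y"
    then obtain g h g' h' where xy: "x = (g, h)" "y = (g', h')"
      and V: "g \<in> pverts G" "g' \<in> pverts G" "h \<in> pverts H" "h' \<in> pverts H" by auto
    obtain p where p: "alternating_path G a g g' p" using exG V by blast
    obtain q where q: "alternating_path H b h h' q" using exH V by blast
    note pD = alternating_pathD[OF p] and qD = alternating_pathD[OF q]
    show "\<exists>P\<subseteq>paths_between (G \<boxtimes> H) x y. finite P \<and> card P = 2 \<and> internally_disjoint P \<and> (\<forall>p\<in>P. vertex_proper c p)"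
    proof (cases "g = g' \<or> h = h'")
      case False
      \<comment> \<open>Two sides of a rectangle: \<open>r\<close> follows row \<open>h\<close> and
        then column \<open>g'\<close>, while \<open>s\<close> below follows column \<open>g\<close>
        and then row \<open>h'\<close>. They meet only in \<open>x\<close> and \<open>y\<close>, and
        the corner \<open>(g, h')\<close> lies on \<open>s\<close> only.\<close>
      have "set (map (\<lambda>x. (x, h)) p) \<inter> set (map (\<lambda>y. (g', y)) q) \<subseteq> {(g', h)}" by auto
      then obtain r where r: "alternating_path (G \<boxtimes> H) c x y r"
        "set r = set (map (\<lambda>x. (x, h)) p) \<union> set (map (\<lambda>y. (g', y)) q)"
        using alternating_path_append[OF row[OF p V(3)] col[OF q V(2)]] xy by metis
      have "set (map (\<lambda>y. (g, y)) q) \<inter> set (map (\<lambda>x. (x, h')) p) \<subseteq> {(g, h')}" by auto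
      then obtain s where s: "alternating_path (G \<boxtimes> H) c x y s"
        "set s = set (map (\<lambda>y. (g, y)) q) \<union> set (map (\<lambda>x. (x, h')) p)"
        using alternating_path_append[OF col[OF q V(1)] row[OF p V(4)]] xy by metis
      have "set r \<inter> set s = {x, y}" using r(2) s(2) False pD(1,2) qD(1,2) xy by auto
      moreover have "(g, h') \<in> set s" "(g, h') \<notin> {x, y}" using s(2) False qD(2) xy by auto
      ultimately show ?thesis using ex_two_disjoint_alternating_paths[OF r(1) s(1)] by blast
    next
      case True
      then consider "g \<noteq> g'" "h = h'" | "g = g'" "h \<noteq> h'" using ne xy by auto
      then show ?thesis
      proof cases
        case 1
        \<comment> \<open>Both vertices lie in row \<open>h\<close>; the second path runs along the
          copy of \<open>p\<close> in the neighboring row \<open>k\<close>.\<close>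
        obtain k where k: "(h, k) \<in> parcs H" "b h \<noteq> b k" using nbr[OF H V(3) exH[OF V(3)]] by blast
        note hk = nontrivial_connected_graphD(2-4)[OF H k(1)]
        show ?thesis
          by (rule ex_two_disjoint_paths_rails[OF GH, where p = "map (\<lambda>x. (x, h)) p"
                and q = "map (\<lambda>x. (x, k)) p" and u' = "(g, k)" and v' = "(g', k)"])
            (use 1 xy row[OF p] V k hk c_col in \<open>auto simp: strong_product_def\<close>)
      next
        case 2
        obtain k where k: "(g, k) \<in> parcs G" "a g \<noteq> a k" using nbr[OF G V(1) exG[OF V(1)]] by blast
        note gk = nontrivial_connected_graphD(2-4)[OF G k(1)]
        show ?thesis
          by (rule ex_two_disjoint_paths_rails[OF GH, where p = "map (\<lambda>y. (g, y)) q"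
                and q = "map (\<lambda>y. (k, y)) q" and u' = "(k, h)" and v' = "(k, h')"])
            (use 2 xy col[OF q] V k gk c_row in \<open>auto simp: strong_product_def\<close>)
      qed
    qed
  qed
  moreover have "c ` pverts (G \<boxtimes> H) \<subseteq> {..<2}" by (auto simp: c_def)
  ultimately show ?thesis using that by blast
qed

section \<open>Common neighbours\<close>

text \<open>Lazy midpoints may be ends: \<open>u\<close> and a neighbor serve if
  \<open>u = v\<close>, and \<open>u\<close> and \<open>v\<close> themselves if they are
  adjacent.\<close>

lemma ex_two_midpoints_near:
  assumes G: "nontrivial_connected_graph G" and uv: "u \<in> pverts G" "v \<in> pverts G"
    and d: "gdist G u v \<le> 1"
  shows "\<exists>x y. x \<noteq> y \<and> lazy_adj G u x \<and> lazy_adj G x v \<and> lazy_adj G u y \<and> lazy_adj G y v"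
proof (cases "u = v")
  case True
  obtain w where "(u, w) \<in> parcs G" using ex_neighbour[OF G uv(1)] .
  then show ?thesis
    using True uv nontrivial_connected_graphD(2-4)[OF G, of u w]
    by (intro exI[of _ u] exI[of _ w]) (auto simp: lazy_adj_def)
next
  case False
  have "lazy_adj G u v" using gdist_le_1_iff[OF G uv] d by simp
  then show ?thesis using False uv by (intro exI[of _ u] exI[of _ v]) (auto simp: lazy_adj_def)
qed

text \<open>At distance 2 a lazy midpoint cannot be an end, so its lazy steps are edges. This
  translates \<open>property_P\<close> into the language of midpoints.\<close>

lemma common_neighbour_iff_midpoint:
  assumes G: "nontrivial_connected_graph G" and uv: "u \<in> pverts G" "v \<in> pverts G"
    and d: "gdist G u v = 2"
  shows "(u, w) \<in> parcs G \<and> (v, w) \<in> parcs G \<longleftrightarrow> lazy_adj G u w \<and> lazy_adj G w v"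
proof -
  have "\<not> lazy_adj G u v" using gdist_le_1_iff[OF G uv] d by simp
  then have "u \<noteq> w" "v \<noteq> w" if "lazy_adj G u w \<and> lazy_adj G w v" using that by auto
  then show ?thesis
    using lazy_adj_sym[OF G] by (auto simp: arc_iff_lazy_adj[OF G])
qed

lemma ex_two_midpoints:
  assumes G: "nontrivial_connected_graph G" and uv: "u \<in> pverts G" "v \<in> pverts G"
    and d: "gdist G u v = 2" and nP: "\<not> property_P G"
  shows "\<exists>x y. x \<noteq> y \<and> lazy_adj G u x \<and> lazy_adj G x v \<and> lazy_adj G u y \<and> lazy_adj G y v"
proof -
  obtain w where w: "lazy_adj G u w" "lazy_adj G w v" using gdist_le_2_iff[OF G uv] d by auto
  have "\<not> (\<exists>!w. lazy_adj G u w \<and> lazy_adj G w v)"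
    using nP uv d unfolding property_P_def common_neighbour_iff_midpoint[OF G uv d, symmetric] by blast
  then show ?thesis using w by metis
qed

text \<open>Adjacent vertices use their edge and a path with one internal vertex, nonadjacent ones
  two paths with one internal vertex each. Such paths are vertex-proper under every
  coloring.\<close>

lemma one_colour_proper_2_connected:
  assumes K: "nontrivial_connected_graph K"
    and adj: "\<And>u v. u \<in> pverts K \<Longrightarrow> v \<in> pverts K \<Longrightarrow> u \<noteq> v \<Longrightarrow> lazy_adj K u v \<Longrightarrow>
      \<exists>w. w \<noteq> u \<and> w \<noteq> v \<and> lazy_adj K u w \<and> lazy_adj K w v"
    and nonadj: "\<And>u v. u \<in> pverts K \<Longrightarrow> v \<in> pverts K \<Longrightarrow> \<not> lazy_adj K u v \<Longrightarrow>
      \<exists>w w'. w \<noteq> w' \<and> lazy_adj K u w \<and> lazy_adj K w v \<and> lazy_adj K u w' \<and> lazy_adj K w' v"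
  shows "proper_vertex_connected 2 K c"
  unfolding proper_vertex_connected_def
proof (intro ballI impI)
  fix u v assume uv: "u \<in> pverts K" "v \<in> pverts K" "u \<noteq> v"
  have path: "[u, w, v] \<in> paths_between K u v \<and> vertex_proper c [u, w, v]"
    if "w \<noteq> u" "w \<noteq> v" "lazy_adj K u w" "lazy_adj K w v" for w
  proof -
    have "w \<in> pverts K" using that(3) by (simp add: lazy_adj_def)
    then show ?thesis
      using that uv vertex_proper_short[of "[u, w, v]" c]
      by (auto simp: paths_between_iff arc_iff_lazy_adj[OF K])
  qed
  show "\<exists>P\<subseteq>paths_between K u v. finite P \<and> card P = 2 \<and> internally_disjoint P \<and> (\<forall>p\<in>P. vertex_proper c p)"
  proof (cases "lazy_adj K u v")
    case True
    then obtain w where w: "w \<noteq> u" "w \<noteq> v" "lazy_adj K u w" "lazy_adj K w v" using adj uv by blast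
    have "[u, v] \<in> paths_between K u v" "vertex_proper c [u, v]"
      using True uv vertex_proper_short[of "[u, v]" c] by (auto simp: paths_between_iff arc_iff_lazy_adj[OF K])
    then show ?thesis
      using path[OF w] by (intro ex_two_disjoint_paths[of "[u, v]" _ _ _ "[u, w, v]"]) auto
  next
    case False
    then obtain w w' where w: "w \<noteq> w'" "lazy_adj K u w" "lazy_adj K w v" "lazy_adj K u w'" "lazy_adj K w' v"
      using nonadj uv by blast
    then have "w \<noteq> u" "w \<noteq> v" "w' \<noteq> u" "w' \<noteq> v" using False by auto
    then show ?thesis
      using path[of w] path[of w'] w by (intro ex_two_disjoint_paths[of "[u, w, v]" _ _ _ "[u, w', v]"]) auto
  qed
qed

text \<open>Midpoints in the product are pairs of midpoints, so two of them exist as soon as one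
  factor offers two and the other offers one.\<close>

lemma pvc_2_eq_1:
  assumes G: "nontrivial_connected_graph G" and H: "nontrivial_connected_graph H"
    and d: "diam G \<le> 2" "diam H \<le> 2"
    and nP: "\<not> (diam G = 2 \<and> diam H = 2 \<and> property_P G \<and> property_P H)"
  shows "pvc_k 2 (G \<boxtimes> H) = 1"
proof (rule pvc_k_eqI[where c = "\<lambda>_. 0"])
  note GH = nontrivial_connected_strong_product[OF G H]
  note la = lazy_adj_strong_product[OF G H]
  show "proper_vertex_connected 2 (G \<boxtimes> H) (\<lambda>_. 0)"
  proof (rule one_colour_proper_2_connected[OF GH])
    fix u v assume V: "u \<in> pverts (G \<boxtimes> H)" "v \<in> pverts (G \<boxtimes> H)" and uv: "lazy_adj (G \<boxtimes> H) u v"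
    then have "gdist G (fst u) (fst v) \<le> 1" "gdist H (snd u) (snd v) \<le> 1"
      using la gdist_le_1_iff[OF G] gdist_le_1_iff[OF H] by auto
    then obtain x x' y y' where
      x: "x \<noteq> x'" "lazy_adj G (fst u) x" "lazy_adj G x (fst v)" "lazy_adj G (fst u) x'" "lazy_adj G x' (fst v)"
      and y: "y \<noteq> y'" "lazy_adj H (snd u) y" "lazy_adj H y (snd v)" "lazy_adj H (snd u) y'" "lazy_adj H y' (snd v)"
      using ex_two_midpoints_near[OF G, of "fst u" "fst v"] ex_two_midpoints_near[OF H, of "snd u" "snd v"] V
      by auto
    \<comment> \<open>Two midpoints in each factor give a grid of four; three of these already
      cannot all be ends.\<close>
    have "card {(x, y), (x, y'), (x', y)} = 3" using x(1) y(1) by simp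
    moreover have "card {u, v} \<le> 2" by (simp add: card_insert_if)
    ultimately have "\<not> {(x, y), (x, y'), (x', y)} \<subseteq> {u, v}"
      using card_mono[of "{u, v}" "{(x, y), (x, y'), (x', y)}"] by auto
    then obtain w where "w \<in> {(x, y), (x, y'), (x', y)}" "w \<noteq> u" "w \<noteq> v" by blast
    then show "\<exists>w. w \<noteq> u \<and> w \<noteq> v \<and> lazy_adj (G \<boxtimes> H) u w \<and> lazy_adj (G \<boxtimes> H) w v"
      using x y la by (intro exI[of _ w]) auto
  next
    fix u v assume V: "u \<in> pverts (G \<boxtimes> H)" "v \<in> pverts (G \<boxtimes> H)"
    define MG where "MG = (\<lambda>x. lazy_adj G (fst u) x \<and> lazy_adj G x (fst v))"
    define MH where "MH = (\<lambda>y. lazy_adj H (snd u) y \<and> lazy_adj H y (snd v))"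
    have V': "fst u \<in> pverts G" "fst v \<in> pverts G" "snd u \<in> pverts H" "snd v \<in> pverts H" using V by auto
    have dG: "gdist G (fst u) (fst v) \<le> diam G" and dH: "gdist H (snd u) (snd v) \<le> diam H"
      using gdist_le_diam[OF G V'(1,2)] gdist_le_diam[OF H V'(3,4)] by blast+
    have "\<exists>x. MG x" "\<exists>y. MH y"
      using gdist_le_2_iff[OF G V'(1,2)] gdist_le_2_iff[OF H V'(3,4)] dG dH d unfolding MG_def MH_def by auto
    moreover have "(\<exists>x x'. x \<noteq> x' \<and> MG x \<and> MG x') \<or> (\<exists>y y'. y \<noteq> y' \<and> MH y \<and> MH y')"
    proof (cases "gdist G (fst u) (fst v) = 2 \<and> gdist H (snd u) (snd v) = 2")
      case True
      \<comment> \<open>A pair at distance 2 in each factor forces both diameters to equal 2, so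
        \<open>nP\<close> applies.\<close>
      then have "\<not> property_P G \<or> \<not> property_P H" using nP dG dH d by auto
      then show ?thesis
        using True ex_two_midpoints[OF G V'(1,2)] ex_two_midpoints[OF H V'(3,4)] unfolding MG_def MH_def by blast
    next
      case False
      then have "gdist G (fst u) (fst v) \<le> 1 \<or> gdist H (snd u) (snd v) \<le> 1" using dG dH d by linarith
      then show ?thesis
        using ex_two_midpoints_near[OF G V'(1,2)] ex_two_midpoints_near[OF H V'(3,4)] unfolding MG_def MH_def by blast
    qed
    moreover have "lazy_adj (G \<boxtimes> H) u (x, y) \<and> lazy_adj (G \<boxtimes> H) (x, y) v" if "MG x" "MH y" for x y
      using that la by (simp add: MG_def MH_def)
    ultimately show "\<exists>w w'. w \<noteq> w' \<and> lazy_adj (G \<boxtimes> H) u w \<and> lazy_adj (G \<boxtimes> H) w v \<and>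
        lazy_adj (G \<boxtimes> H) u w' \<and> lazy_adj (G \<boxtimes> H) w' v"
      by (metis prod.inject)
  qed
qed (use colours_ge_1[OF nontrivial_connected_strong_product[OF G H]] in auto)

text \<open>Unique common neighbors \<open>x\<close> and \<open>y\<close> in the factors leave
  \<open>(x, y)\<close> as the only midpoint of \<open>(g, h)\<close> and \<open>(g', h')\<close>.
  These are at distance 2, so one color admits only a single vertex-proper path between
  them.\<close>

lemma colours_ge_2_property_P:
  assumes G: "nontrivial_connected_graph G" and H: "nontrivial_connected_graph H"
    and P: "property_P G" "property_P H"
    and c: "c ` pverts (G \<boxtimes> H) \<subseteq> {..<m}" and pc: "proper_vertex_connected 2 (G \<boxtimes> H) c"
  shows "2 \<le> m"
proof (rule ccontr)
  assume "\<not> 2 \<le> m"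
  note GH = nontrivial_connected_strong_product[OF G H]
  have m: "m = 1" using \<open>\<not> 2 \<le> m\<close> colours_ge_1[OF GH c] by simp
  obtain g g' x where g: "g \<in> pverts G" "g' \<in> pverts G" "gdist G g g' = 2"
    and x: "\<And>w. (g, w) \<in> parcs G \<and> (g', w) \<in> parcs G \<Longrightarrow> w = x"
    using P(1) unfolding property_P_def by blast
  obtain h h' y where h: "h \<in> pverts H" "h' \<in> pverts H" "gdist H h h' = 2"
    and y: "\<And>w. (h, w) \<in> parcs H \<and> (h', w) \<in> parcs H \<Longrightarrow> w = y"
    using P(2) unfolding property_P_def by blast
  have "g \<noteq> g'" using g gdist_eq_0_iff[OF G g(1,2)] by auto
  then obtain Q where Q: "Q \<subseteq> paths_between (G \<boxtimes> H) (g, h) (g', h')" "card Q = 2" "\<forall>p\<in>Q. vertex_proper c p"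
    using pc g h unfolding proper_vertex_connected_def by force
  have "p = [(g, h), (x, y), (g', h')]" if "p \<in> Q" for p
  proof -
    have p: "p \<in> paths_between (G \<boxtimes> H) (g, h) (g', h')" "vertex_proper c p" using Q that by auto
    then have "length p \<le> 3"
      using c m by (intro vertex_proper_constant_imp_short[of c]) (auto simp: paths_between_iff)
    moreover have "2 \<le> length p - 1"
      using gdist_le_path[OF p(1)] gdist_strong_product[OF G H g(1,2) h(1,2)] g h by simp
    ultimately have "length p = 3" by simp
    then obtain w where w: "p = [(g, h), w, (g', h')]"
      using p(1) by (cases p; cases "tl p"; cases "tl (tl p)") (auto simp: paths_between_iff)
    then have "lazy_adj (G \<boxtimes> H) (g, h) w" "lazy_adj (G \<boxtimes> H) w (g', h')"
      using p(1) by (auto simp: paths_between_iff arc_iff_lazy_adj[OF GH])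
    then have "fst w = x" "snd w = y"
      using x y common_neighbour_iff_midpoint[OF G g] common_neighbour_iff_midpoint[OF H h]
      by (auto simp: lazy_adj_strong_product[OF G H])
    then show ?thesis using w by auto
  qed
  then have "Q \<subseteq> {[(g, h), (x, y), (g', h')]}" by auto
  then have "card Q \<le> card {[(g, h), (x, y), (g', h')]}" by (intro card_mono) auto
  then show False using Q(2) by simp
qed

lemma complete_graph_strong_product_iff:
  assumes G: "nontrivial_connected_graph G" and H: "nontrivial_connected_graph H"
  shows "complete_graph (G \<boxtimes> H) \<longleftrightarrow> complete_graph G \<and> complete_graph H"
  using complete_graph_iff_diam[OF G] complete_graph_iff_diam[OF H]
    complete_graph_iff_diam[OF nontrivial_connected_strong_product[OF G H]]
  by (simp add: diam_strong_product[OF G H])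

theorem theorem5p2:
  fixes G :: "'a pair_pre_digraph" and H :: "'b pair_pre_digraph"
  assumes "nontrivial_connected_graph G" and "nontrivial_connected_graph H"
  shows
    "((complete_graph G \<and> complete_graph H \<longrightarrow> pvc (G \<boxtimes> H) = 0) \<and>
      (diam G \<ge> 3 \<or> diam H \<ge> 3 \<longrightarrow> pvc (G \<boxtimes> H) = 2) \<and>
      (\<not> (complete_graph G \<and> complete_graph H) \<and> \<not> (diam G \<ge> 3 \<or> diam H \<ge> 3)
         \<longrightarrow> pvc (G \<boxtimes> H) = 1))
     \<and>
     (if diam G \<le> 2 \<and> diam H \<le> 2 \<and>
         \<not> (diam G = 2 \<and> diam H = 2 \<and> property_P G \<and> property_P H)
      then pvc_k 2 (G \<boxtimes> H) = 1
      else pvc_k 2 (G \<boxtimes> H) = 2)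
     \<and>
     ((complete_graph G \<and> complete_graph H \<longrightarrow> spvc (G \<boxtimes> H) = 0) \<and>
      ((diam G = 2 \<and> diam H \<le> 2) \<or> (diam G \<le> 2 \<and> diam H = 2) \<longrightarrow> spvc (G \<boxtimes> H) = 1) \<and>
      (diam G \<le> 2 \<and> diam H \<ge> 3 \<longrightarrow> spvc (G \<boxtimes> H) \<le> spvc H) \<and>
      (\<exists>(G' :: nat pair_pre_digraph) (H' :: nat pair_pre_digraph).
         nontrivial_connected_graph G' \<and> nontrivial_connected_graph H' \<and>
         diam G' \<le> 2 \<and> diam H' \<ge> 3 \<and> spvc (G' \<boxtimes> H') = spvc H') \<and>
      (diam G \<ge> 3 \<and> diam H \<ge> 3 \<longrightarrow> spvc (G \<boxtimes> H) \<le> spvc G * spvc H))"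
proof -
  note G = assms(1) and H = assms(2)
  note GH = nontrivial_connected_strong_product[OF G H]
  note cG = complete_graph_iff_diam[OF G] and cH = complete_graph_iff_diam[OF H]
  note cGH = complete_graph_strong_product_iff[OF G H] and dGH = diam_strong_product[OF G H]
  \<comment> \<open>One coloring gives the upper bound 2 for both \<open>pvc\<close> and
    \<open>pvc_k 2\<close>, since one of two disjoint paths may be dropped.\<close>
  obtain c where c: "c ` pverts (G \<boxtimes> H) \<subseteq> {..<2}" "proper_vertex_connected 2 (G \<boxtimes> H) c"
    using two_colours_proper_2_connected[OF G H] .
  have pvc: "pvc (G \<boxtimes> H) = 2" if "diam G \<ge> 3 \<or> diam H \<ge> 3"
  proof (rule pvc_k_eqI[OF _ c(1) proper_vertex_connected_2_imp_1[OF c(2)]])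
    show "\<not> (1 = (1::nat) \<and> complete_graph (G \<boxtimes> H))" using that by (auto simp: cGH cG cH)
    show "2 \<le> m" if "b ` pverts (G \<boxtimes> H) \<subseteq> {..<m}" "proper_vertex_connected 1 (G \<boxtimes> H) b" for b m
      using colours_ge_2_proper_vertex_connected[OF GH that(1) _ _ that(2)] \<open>diam G \<ge> 3 \<or> diam H \<ge> 3\<close>
      by (auto simp: dGH)
  qed
  have pvc_2: "pvc_k 2 (G \<boxtimes> H) = 2"
    if "\<not> (diam G \<le> 2 \<and> diam H \<le> 2 \<and> \<not> (diam G = 2 \<and> diam H = 2 \<and> property_P G \<and> property_P H))"
  proof (rule pvc_k_eqI[OF _ c])
    show "2 \<le> m" if b: "b ` pverts (G \<boxtimes> H) \<subseteq> {..<m}" "proper_vertex_connected 2 (G \<boxtimes> H) b" for b m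
    proof (cases "diam (G \<boxtimes> H) \<ge> 3")
      case True
      then show ?thesis by (rule colours_ge_2_proper_vertex_connected[OF GH b(1) _ _ b(2)]) simp
    next
      case False
      \<comment> \<open>With both diameters at most 2, only the exceptional case remains.\<close>
      then have "property_P G" "property_P H"
        using \<open>\<not> (diam G \<le> 2 \<and> _)\<close> by (auto simp: dGH)
      then show ?thesis by (rule colours_ge_2_property_P[OF G H _ _ b])
    qed
  qed simp
  \<comment> \<open>A factor that is not complete has diameter at least 2, and neither diameter
    exceeds 2.\<close>
  have eq_2: "diam (G \<boxtimes> H) = 2" if "\<not> (complete_graph G \<and> complete_graph H)" "\<not> (diam G \<ge> 3 \<or> diam H \<ge> 3)"
    using that by (auto simp: cG cH dGH)
  have sharp: "\<exists>(G' :: nat pair_pre_digraph) (H' :: nat pair_pre_digraph).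
         nontrivial_connected_graph G' \<and> nontrivial_connected_graph H' \<and>
         diam G' \<le> 2 \<and> diam H' \<ge> 3 \<and> spvc (G' \<boxtimes> H') = spvc H'"
    using nontrivial_connected_path_graph[of 2] nontrivial_connected_path_graph[of 4]
      diam_path_graph_2_le diam_path_graph_ge[of 4] spvc_strong_product_sharp
    by (intro exI[of _ "path_graph 2"] exI[of _ "path_graph 4"]) auto
  show ?thesis
  proof (intro conjI impI)
    show "pvc (G \<boxtimes> H) = 0" if "complete_graph G \<and> complete_graph H"
      using that by (simp add: pvc_k_def cGH)
    show "spvc (G \<boxtimes> H) = 0" if "complete_graph G \<and> complete_graph H"
      using that by (simp add: spvc_def cGH)
    show "pvc (G \<boxtimes> H) = 1"
      if "\<not> (complete_graph G \<and> complete_graph H) \<and> \<not> (diam G \<ge> 3 \<or> diam H \<ge> 3)"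
      using that eq_2 pvc_eq_1[OF GH] by blast
    show "if diam G \<le> 2 \<and> diam H \<le> 2 \<and> \<not> (diam G = 2 \<and> diam H = 2 \<and> property_P G \<and> property_P H)
      then pvc_k 2 (G \<boxtimes> H) = 1 else pvc_k 2 (G \<boxtimes> H) = 2"
      using pvc_2 pvc_2_eq_1[OF G H] by (auto split: if_split)
    show "spvc (G \<boxtimes> H) = 1" if "(diam G = 2 \<and> diam H \<le> 2) \<or> (diam G \<le> 2 \<and> diam H = 2)"
      using that by (intro spvc_eq_1[OF GH]) (auto simp: dGH)
    show "spvc (G \<boxtimes> H) \<le> spvc H" if "diam G \<le> 2 \<and> diam H \<ge> 3"
      using that spvc_strong_product_le_snd[OF G H] by blast
    show "spvc (G \<boxtimes> H) \<le> spvc G * spvc H" if "diam G \<ge> 3 \<and> diam H \<ge> 3"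
      using that by (intro spvc_strong_product_le_mult[OF G H]) (auto simp: cG cH)
  qed (use pvc sharp in auto)
qed

end
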